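(* Let $d$ be a positive integer, let $a$ be a constant with $-d<a\le 0$, and let $p=p(n)\in[0,1]$ satisfy $p=n^{a}(1+o(1))$ as $n\to\infty$. Then there exists a constant $b=b(a)$ such that, asymptotically almost surely, $$F([n]^d_p)=n^{b+o(1)}.$$ Moreover, $$b(a)=\begin{cases} a+d & \text{if } -d<a\le -2d/3,\\ d/3 & \text{if } -2d/3\le a\le -d/3,\\ (a+d)/2 & \text{if } -d/3\le a\le 0.\end{cases}$$
   Context: For positive integers $d,n$, $[n]^d$ denotes the set of all vectors $(a_1,\dots,a_d)$ of integers with $0\le a_i\le n-1$. A subset $S\subseteq[n]^d$ is a Sidon set if all sums of two (not necessarily distinct) vectors of $S$ are distinct, i.e. whenever $a+b=c+e$ with $a,b,c,e\in S$ one has $\{a,b\}=\{c,e\}$. $[n]^d_p$ denotes the random subset of $[n]^d$ obtained by choosing each element independently with probability $p$, and $F([n]^d_p)$ is the maximum size of a Sidon set contained in $[n]^d_p$. The integer $d$ is fixed and asymptotics are as $n\to\infty$. "Asymptotically almost surely" (a.a.s.) means with probability tending to $1$ as $n\to\infty$; "a.a.s. $F([n]^d_p)=n^{b+o(1)}$" means that for every $\eta>0$, $\Pr[n^{b-\eta}\le F([n]^d_p)\le n^{b+\eta}]\to1$. *)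

theory Defs
  imports "HOL-Probability.Probability" "HOL-Library.Landau_Symbols"
begin

(* The dimension d is CARD('d). *)
definition grid :: "nat \<Rightarrow> (int ^ 'd) set" where
  "grid n = {x. \<forall>i. 0 \<le> x $ i \<and> x $ i \<le> int n - 1}"

definition sidon :: "'a::ab_semigroup_add set \<Rightarrow> bool" where
  "sidon S \<longleftrightarrow> (\<forall>a\<in>S. \<forall>b\<in>S. \<forall>c\<in>S. \<forall>e\<in>S. a + b = c + e \<longrightarrow> {a, b} = {c, e})"

(* Meaningful for finite T only, which is the case for subsets of the grid. *)
definition max_sidon :: "'a::ab_semigroup_add set \<Rightarrow> nat" where
  "max_sidon T = Max {card S | S. S \<subseteq> T \<and> sidon S}"

(* Pi_pmf makes the indicators of the grid points independent Bernoulli(q) variables;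
   bernoulli_pmf has its intended meaning for 0 \<le> q \<le> 1. *)
definition random_grid :: "nat \<Rightarrow> real \<Rightarrow> (int ^ 'd) set pmf" where
  "random_grid n q =
     map_pmf (\<lambda>f. {x \<in> grid n. f x}) (Pi_pmf (grid n) False (\<lambda>_. bernoulli_pmf q))"

(* M n is the distribution at stage n; the property says that, asymptotically almost surely,
   X \<omega> = n^(b + o(1)) for \<omega> distributed according to M n. *)
definition aas_power :: "(nat \<Rightarrow> 'a pmf) \<Rightarrow> ('a \<Rightarrow> nat) \<Rightarrow> real \<Rightarrow> bool" where
  "aas_power M X b \<longleftrightarrow> (\<forall>\<eta>>0.
     (\<lambda>n. measure_pmf.prob (M n)
        {\<omega>. real n powr (b - \<eta>) \<le> real (X \<omega>) \<and> real (X \<omega>) \<le> real n powr (b + \<eta>)})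
     \<longlonglongrightarrow> 1)"

end

theory Submission
  imports Defs "HOL-Real_Asymp.Real_Asymp" "HOL-Computational_Algebra.Primes"
begin

text \<open>
  Write \<open>N = n ^ d\<close> for the number of grid points. The three cases of the exponent are
  \<open>b = min (a + d) (max (d / 3) ((a + d) / 2))\<close>, so the theorem amounts to two upper and two lower bounds
  for the maximum size \<open>F\<close> of a Sidon set in the random set, each up to a factor \<open>n powr \<eta>\<close>.

  \<^item> \<open>F\<close> is at most the number of random points, which is about \<open>p N\<close>.

  \<^item> \<open>F\<close> is at most about \<open>max (N powr (1/3)) (sqrt (p N))\<close>. Fix a Sidon set \<open>S\<close> with \<open>s\<close> points and
    join two grid points \<open>x\<close> and \<open>y\<close> when \<open>x + a = y + b\<close> for some \<open>a, b\<close> in \<open>S\<close>. A Sidon set that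
    contains \<open>S\<close> is independent in this graph outside \<open>S\<close>, and the graph has density about \<open>s\<^sup>2 / N\<close> on
    every set of more than \<open>C N / s\<close> points. By the Kleitman--Winston method, the large Sidon
    sets lie in few sets of size about \<open>C N / s\<close>, namely \<open>N ^ (s + j)\<close> many with \<open>j\<close> about
    \<open>N / s\<^sup>2\<close> up to logarithms (\<open>sidon_containers\<close>). With \<open>s\<close> slightly below \<open>m\<close>, a random set has
    \<open>m\<close> points in one of these sets only if \<open>m\<^sup>3\<close> is at most about \<open>N\<close> or \<open>m\<^sup>2\<close> is at most about
    \<open>p N\<close>.

  \<^item> \<open>F\<close> is at least about \<open>min (p N) (N powr (1/3))\<close>. A maximal Sidon subset \<open>S\<close> with \<open>k\<close> points
    blocks at most \<open>k\<^sup>3 + k\<^sup>2\<close> other points, and all other random points must be blocked. If \<open>k\<^sup>3\<close>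
    is well below \<open>N\<close>, this forces the random set to avoid half of the grid, which has probability
    \<open>exp (- p N / 2)\<close> for each of the roughly \<open>N ^ k\<close> sets \<open>S\<close> (\<open>prob_max_sidon_less\<close>).

  \<^item> \<open>F\<close> is at least about \<open>sqrt (p N)\<close>. Cut the grid into cubes with slightly more than \<open>1 / p\<close>
    points, so that each of them contains a random point. There are about \<open>p N\<close> cubes, and
    their positions contain a Sidon set of size close to \<open>sqrt (p N)\<close>, which comes from the
    integer construction of Erdos and Turan by writing integers in base \<open>m\<close>. One random point
    from each cube of that set gives a Sidon set, provided that the points are taken from the lower
    half of each cube in every coordinate, so that sums do not carry (\<open>prob_max_sidon_less_dense\<close>).
\<close>

section \<open>The grid and its random subset\<close>

lemma finite_grid: "finite (grid n :: (int ^ 'd) set)"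
  and card_grid: "card (grid n :: (int ^ 'd) set) = n ^ CARD('d)"
proof -
  have grid_eq: "(grid n :: (int ^ 'd) set) = vec_lambda ` (UNIV \<rightarrow>\<^sub>E {0..<int n})" (is "_ = vec_lambda ` ?F")
  proof (intro equalityI subsetI)
    fix x :: "int ^ 'd" assume "x \<in> grid n"
    then have "($) x \<in> ?F"
      by (auto simp: grid_def)
    then show "x \<in> vec_lambda ` ?F"
      by (metis image_eqI vec_nth_inverse)
  next
    fix x :: "int ^ 'd" assume "x \<in> vec_lambda ` ?F"
    then obtain f where f: "f \<in> ?F" "x = vec_lambda f"
      by blast
    have "0 \<le> f i \<and> f i < int n" for i
      using PiE_mem[OF f(1), of i] by simp
    then show "x \<in> grid n"
      using f(2) by (simp add: grid_def)
  qed
  have inj: "inj_on vec_lambda ?F"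
    by (metis inj_onI vec_lambda_inject UNIV_I)
  show "finite (grid n :: (int ^ 'd) set)"
    unfolding grid_eq by (intro finite_imageI finite_PiE) auto
  show "card (grid n :: (int ^ 'd) set) = n ^ CARD('d)"
    unfolding grid_eq using card_image[OF inj] by (simp add: card_PiE)
qed

lemma set_pmf_random_grid: "\<omega> \<in> set_pmf (random_grid n q) \<Longrightarrow> \<omega> \<subseteq> grid n"
  by (auto simp: random_grid_def)

lemma prob_random_grid_coordinates:
  fixes K :: "(int ^ 'd) set"
  assumes "K \<subseteq> grid n"
  shows "measure_pmf.prob (random_grid n q) {\<omega>. \<forall>x\<in>K. (x \<in> \<omega>) = b} = pmf (bernoulli_pmf q) b ^ card K"
proof -
  let ?B = "\<lambda>x. if x \<in> K then {b} else UNIV"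
  have "measure_pmf.prob (random_grid n q) {\<omega>. \<forall>x\<in>K. (x \<in> \<omega>) = b}
        = measure_pmf.prob (Pi_pmf (grid n) False (\<lambda>_. bernoulli_pmf q)) (Pi (grid n) ?B)"
    unfolding random_grid_def measure_map_pmf
    by (rule arg_cong[where f = "measure_pmf.prob _"]) (use assms in \<open>auto simp: Pi_def\<close>)
  also have "\<dots> = (\<Prod>x\<in>grid n. measure_pmf.prob (bernoulli_pmf q) (?B x))"
    by (rule measure_Pi_pmf_Pi) (rule finite_grid)
  also have "\<dots> = (\<Prod>x\<in>K. measure_pmf.prob (bernoulli_pmf q) (?B x))"
    by (rule prod.mono_neutral_right) (use assms finite_grid in \<open>auto simp: measure_pmf.prob_space\<close>)
  also have "\<dots> = (\<Prod>x\<in>K. pmf (bernoulli_pmf q) b)"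
    by (rule prod.cong) (auto simp: measure_pmf_single)
  finally show ?thesis by simp
qed

lemma prob_random_grid_superset:
  assumes "K \<subseteq> grid n" "0 \<le> q" "q \<le> 1"
  shows "measure_pmf.prob (random_grid n q) {\<omega>. K \<subseteq> \<omega>} = q ^ card K"
  using prob_random_grid_coordinates[OF assms(1), of q True] assms(2,3) by (simp add: subset_eq)

lemma prob_random_grid_avoids:
  assumes "K \<subseteq> grid n" "0 \<le> q" "q \<le> 1"
  shows "measure_pmf.prob (random_grid n q) {\<omega>. K \<inter> \<omega> = {}} \<le> exp (- q * real (card K))"
proof -
  have "measure_pmf.prob (random_grid n q) {\<omega>. K \<inter> \<omega> = {}} = (1 - q) ^ card K"
    using prob_random_grid_coordinates[OF assms(1), of q False] assms(2,3)
    by (simp add: disjoint_iff Ball_def)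
  also have "\<dots> \<le> exp (- q) ^ card K"
    by (rule power_mono) (use assms exp_ge_add_one_self[of "- q"] in auto)
  finally show ?thesis
    by (simp add: exp_of_nat_mult[symmetric] mult.commute)
qed

lemma card_subsets_of_size_le:
  assumes "finite A"
  shows "card {S. S \<subseteq> A \<and> card S = k} \<le> card A ^ k"
  using binomial_le_pow[of k "card A"] binomial_eq_0[of "card A" k] n_subsets[OF assms, of k]
  by (cases "k \<le> card A") (auto simp: binomial_eq_0 not_le)

lemma card_subsets_of_size_less:
  assumes "finite A"
  shows "card {S. S \<subseteq> A \<and> card S < k} \<le> (card A + 1) ^ k"
proof (induction k)
  case (Suc k)
  have fin: "finite {S. S \<subseteq> A \<and> P S}" for P
    using assms by (rule finite_subset[rotated, OF finite_Pow_iff[THEN iffD2]]) auto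
  have "{S. S \<subseteq> A \<and> card S < Suc k} = {S. S \<subseteq> A \<and> card S < k} \<union> {S. S \<subseteq> A \<and> card S = k}"
    by (auto simp: less_Suc_eq)
  then have "card {S. S \<subseteq> A \<and> card S < Suc k} \<le> card {S. S \<subseteq> A \<and> card S < k} + card {S. S \<subseteq> A \<and> card S = k}"
    using card_Un_le[of "{S. S \<subseteq> A \<and> card S < k}" "{S. S \<subseteq> A \<and> card S = k}"] by argo
  also have "card {S. S \<subseteq> A \<and> card S = k} \<le> card A ^ k"
    by (rule card_subsets_of_size_le[OF assms])
  also have "card {S. S \<subseteq> A \<and> card S < k} + card A ^ k \<le> (card A + 1) ^ k + card A * (card A + 1) ^ k"
  proof (cases "k = 0 \<and> card A = 0")
    case True
    then show ?thesis using Suc.IH by simp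
  next
    case False
    have "card A ^ k \<le> card A * (card A + 1) ^ k" if "card A > 0"
    proof -
      have "card A ^ k \<le> (card A + 1) ^ k" by (rule power_mono) auto
      also have "\<dots> \<le> card A * (card A + 1) ^ k" using that by simp
      finally show ?thesis .
    qed
    moreover have "card A ^ k = 0" if "card A = 0"
      using that False by simp
    ultimately show ?thesis
      using Suc.IH by (cases "card A = 0") (simp_all add: power_0_left)
  qed
  also have "(card A + 1) ^ k + card A * (card A + 1) ^ k = (card A + 1) ^ Suc k"
    by simp
  finally show ?case by simp
qed simp

text \<open>
  The events \<open>A i\<close> only have to cover \<open>E\<close> on the support: this lets one use that a random subset of
  the grid is a subset of the grid.
\<close>

lemma prob_union_bound:
  assumes "finite I" and "\<And>\<omega>. \<omega> \<in> set_pmf M \<Longrightarrow> \<omega> \<in> E \<Longrightarrow> \<exists>i\<in>I. \<omega> \<in> A i"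
    and "\<And>i. i \<in> I \<Longrightarrow> measure_pmf.prob M (A i) \<le> c"
  shows "measure_pmf.prob M E \<le> real (card I) * c"
proof -
  have "measure_pmf.prob M E = measure_pmf.prob M (E \<inter> set_pmf M)"
    by (simp add: measure_Int_set_pmf)
  also have "\<dots> \<le> measure_pmf.prob M (\<Union>i\<in>I. A i)"
    by (rule measure_pmf.finite_measure_mono) (use assms(2) in auto)
  also have "\<dots> \<le> (\<Sum>i\<in>I. measure_pmf.prob M (A i))"
    by (rule measure_pmf.finite_measure_subadditive_finite) (use assms(1) in auto)
  also have "\<dots> \<le> real (card I) * c"
    using sum_bounded_above[of I "\<lambda>i. measure_pmf.prob M (A i)" c] assms(3) by simp
  finally show ?thesis .
qed

text \<open>
  A union bound over the \<open>m\<close>-element subsets of \<open>C\<close>. It turns a container into a probability: a large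
  Sidon set inside the random set and inside \<open>C\<close> is in particular a large subset of \<open>\<omega> \<inter> C\<close>.
\<close>

lemma prob_random_grid_large_intersection:
  fixes C :: "(int ^ 'd) set"
  assumes "finite C" "0 \<le> q" "q \<le> 1" "m > 0"
  shows "measure_pmf.prob (random_grid n q) {\<omega>. \<exists>S. S \<subseteq> \<omega> \<inter> C \<and> card S = m}
         \<le> (exp 1 * real (card C) * q / real m) ^ m"
proof -
  let ?I = "{S. S \<subseteq> C \<inter> grid n \<and> card S = m}"
  have fin: "finite (C \<inter> grid n)"
    using assms(1) by simp
  have "measure_pmf.prob (random_grid n q) {\<omega>. \<exists>S. S \<subseteq> \<omega> \<inter> C \<and> card S = m} \<le> real (card ?I) * q ^ m"
  proof (rule prob_union_bound)
    show "finite ?I"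
      by (rule finite_subset[of _ "Pow (C \<inter> grid n)"]) (use fin finite_Pow_iff in \<open>auto simp del: Pow_Int_eq\<close>)
    show "\<exists>S\<in>?I. \<omega> \<in> {\<omega>. S \<subseteq> \<omega>}"
      if "\<omega> \<in> set_pmf (random_grid n q)" "\<omega> \<in> {\<omega>. \<exists>S. S \<subseteq> \<omega> \<inter> C \<and> card S = m}" for \<omega>
      using set_pmf_random_grid[OF that(1)] that(2) by auto
    show "measure_pmf.prob (random_grid n q) {\<omega>. S \<subseteq> \<omega>} \<le> q ^ m" if "S \<in> ?I" for S
      using that prob_random_grid_superset[of S n q] assms by simp
  qed
  also have "\<dots> = real (card (C \<inter> grid n) choose m) * q ^ m"
    by (simp only: n_subsets[OF fin])
  also have "\<dots> \<le> (real (card C) ^ m / fact m) * q ^ m"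
  proof (rule mult_right_mono)
    have "fact m * (card (C \<inter> grid n) choose m) \<le> card (C \<inter> grid n) ^ m"
      using binomial_fact_pow[of "card (C \<inter> grid n)" m] by (simp add: mult.commute)
    also have "\<dots> \<le> card C ^ m"
      by (intro power_mono card_mono) (use assms in auto)
    finally have "fact m * real (card (C \<inter> grid n) choose m) \<le> real (card C) ^ m"
      by (metis (mono_tags, opaque_lifting) of_nat_fact of_nat_le_iff of_nat_mult of_nat_power)
    then show "real (card (C \<inter> grid n) choose m) \<le> real (card C) ^ m / fact m"
      by (simp add: field_simps)
  qed (use assms in simp)
  also have "\<dots> \<le> (exp 1 * real (card C) * q / real m) ^ m"
  proof -
    \<comment> \<open>One term of the exponential series gives \<open>m ^ m / m! \<le> e ^ m\<close>.\<close>
    have "real m ^ m / fact m \<le> exp (real m)"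
      using sum_le_suminf[OF summable_exp_generic[of "real m"], of "{m}"]
      by (simp add: exp_def divide_inverse mult.commute)
    then have "1 / fact m \<le> exp 1 ^ m / real m ^ m"
      using \<open>m > 0\<close> by (simp add: field_simps flip: exp_of_nat_mult)
    then have "real (card C) ^ m * q ^ m * (1 / fact m) \<le> real (card C) ^ m * q ^ m * (exp 1 ^ m / real m ^ m)"
      by (rule mult_left_mono) (use assms in simp)
    then show ?thesis
      by (simp add: power_mult_distrib power_divide mult.commute mult.left_commute)
  qed
  finally show ?thesis .
qed

section \<open>Sidon sets\<close>

lemma sidonI:
  assumes "\<And>a b c e. \<lbrakk>a \<in> S; b \<in> S; c \<in> S; e \<in> S; a + b = c + e\<rbrakk> \<Longrightarrow> {a, b} = {c, e}"
  shows "sidon S"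
  using assms unfolding sidon_def by blast

lemma sidonD:
  "sidon S \<Longrightarrow> a \<in> S \<Longrightarrow> b \<in> S \<Longrightarrow> c \<in> S \<Longrightarrow> e \<in> S \<Longrightarrow> a + b = c + e \<Longrightarrow> {a, b} = {c, e}"
  unfolding sidon_def by blast

lemma sidon_subset: "sidon S \<Longrightarrow> T \<subseteq> S \<Longrightarrow> sidon T"
  unfolding sidon_def by blast

lemma sidon_empty: "sidon {}"
  unfolding sidon_def by blast

context
  fixes T :: "'a::ab_semigroup_add set"
  assumes finite_T: "finite T"
begin

lemma finite_sidon_cards: "finite {card S | S. S \<subseteq> T \<and> sidon S}"
proof -
  have "{card S | S. S \<subseteq> T \<and> sidon S} \<subseteq> card ` Pow T"
    by auto
  then show ?thesis
    using finite_T finite_subset by blast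
qed

lemma card_le_max_sidon: "S \<subseteq> T \<Longrightarrow> sidon S \<Longrightarrow> card S \<le> max_sidon T"
  unfolding max_sidon_def by (rule Max_ge[OF finite_sidon_cards]) blast

lemma max_sidon_attained: obtains S where "S \<subseteq> T" "sidon S" "card S = max_sidon T"
proof -
  have "max_sidon T \<in> {card S | S. S \<subseteq> T \<and> sidon S}"
    unfolding max_sidon_def
    by (rule Max_in[OF finite_sidon_cards]) (use sidon_empty in blast)
  then show ?thesis
    using that by auto
qed

lemma max_sidon_le_card: "max_sidon T \<le> card T"
  by (metis max_sidon_attained card_mono finite_T)

end

section \<open>Maximal Sidon subsets\<close>

definition forbidden :: "'a::ab_semigroup_add set \<Rightarrow> 'a set" where
  "forbidden S = {x. x \<notin> S \<and> \<not> sidon (insert x S)}"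

text \<open>
  A new coincidence must involve \<open>x\<close>. If \<open>x\<close> occurred on both sides, it would cancel and the coincidence
  would be trivial; so it occurs on one side only, once or twice.
\<close>

lemma forbidden_cases:
  fixes S :: "'a::ab_group_add set"
  assumes "sidon S" "x \<in> forbidden S"
  shows "(\<exists>b\<in>S. \<exists>c\<in>S. \<exists>e\<in>S. x = c + e - b) \<or> (\<exists>c\<in>S. \<exists>e\<in>S. x + x = c + e)"
proof -
  have "\<not> sidon (insert x S)"
    using assms(2) by (simp add: forbidden_def)
  then obtain a b c e where abce: "a \<in> insert x S" "b \<in> insert x S" "c \<in> insert x S" "e \<in> insert x S"
      "a + b = c + e" "{a, b} \<noteq> {c, e}"
    unfolding sidon_def by blast
  have solve: ?thesis
    if eq: "x + b = c + e" and b: "b \<in> insert x S" and S: "c \<in> S" "e \<in> S" for b c e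
  proof (cases "b = x")
    case True
    with eq S show ?thesis by auto
  next
    case False
    moreover have "x = c + e - b"
      using eq by (simp add: algebra_simps eq_diff_eq)
    ultimately show ?thesis
      using b S by blast
  qed
  have not_both: "\<not> (x \<in> {a, b} \<and> x \<in> {c, e})"
    using abce(5,6) by (auto simp: add.commute doubleton_eq_iff)
  consider "a \<in> S" "b \<in> S" "c \<in> S" "e \<in> S" | "x = a" | "x = b" | "x = c" | "x = e"
    using abce by blast
  then show ?thesis
  proof cases
    case 1
    then show ?thesis
      using sidonD[OF assms(1)] abce(5,6) by blast
  next
    case 2
    then show ?thesis
      using solve[of b c e] abce not_both by auto
  next
    case 3
    then show ?thesis
      using solve[of a c e] abce not_both by (auto simp: add.commute)
  next
    case 4
    then show ?thesis
      using solve[of e a b] abce not_both by auto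
  next
    case 5
    then show ?thesis
      using solve[of c a b] abce not_both by (auto simp: add.commute)
  qed
qed

text \<open>
  Each \<open>x = c + e - b\<close> is given by a triple from \<open>S\<close>, and \<open>x + x = c + e\<close> by a pair, since doubling is
  injective on integer vectors.
\<close>

lemma card_forbidden_le:
  fixes S :: "(int ^ 'd) set"
  assumes "sidon S" "finite S"
  shows "finite (forbidden S) \<and> card (forbidden S) \<le> card S ^ 3 + card S ^ 2"
proof -
  let ?A = "(\<lambda>(b, c, e). c + e - b) ` (S \<times> S \<times> S)"
  let ?T = "(\<lambda>(c, e). c + e) ` (S \<times> S)"
  let ?B = "(\<lambda>x. x + x) -` ?T"
  have inj: "inj (\<lambda>x :: int ^ 'd. x + x)"
    by (rule injI) (auto simp: vec_eq_iff)
  have sub: "forbidden S \<subseteq> ?A \<union> ?B"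
  proof
    fix x assume "x \<in> forbidden S"
    then show "x \<in> ?A \<union> ?B"
      using forbidden_cases[OF assms(1)] by (force simp: image_iff)
  qed
  have fin: "finite ?A" "finite ?T"
    using assms(2) by auto
  then have finB: "finite ?B"
    using inj by (intro finite_vimageI)
  have "card ?A \<le> card (S \<times> S \<times> S)"
    by (rule card_image_le) (use assms in auto)
  then have A: "card ?A \<le> card S ^ 3"
    by (simp add: card_cartesian_product power3_eq_cube mult.assoc)
  have "card ?B \<le> card ?T"
    using card_vimage_inj_on_le[of "\<lambda>x. x + x" UNIV ?T] inj fin(2) by simp
  also have "\<dots> \<le> card (S \<times> S)"
    by (rule card_image_le) (use assms in auto)
  finally have B: "card ?B \<le> card S ^ 2"
    by (simp add: card_cartesian_product power2_eq_square)
  have "card (forbidden S) \<le> card (?A \<union> ?B)"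
    by (rule card_mono[OF _ sub]) (use fin finB in blast)
  also have "\<dots> \<le> card S ^ 3 + card S ^ 2"
    using card_Un_le[of ?A ?B] A B by linarith
  finally show ?thesis
    using finite_subset[OF sub] fin finB by blast
qed

text \<open>
  If the largest Sidon set \<open>S\<close> in the random set has fewer than \<open>k\<close> points, then it is maximal under
  inclusion, so all points of the random set outside \<open>S\<close> are forbidden by \<open>S\<close>. Hence the random set
  misses all remaining points, at least half of the grid when \<open>k\<^sup>3\<close> is small against \<open>n ^ d\<close>, and the
  union over all choices of \<open>S\<close> is cheap.
\<close>

lemma prob_max_sidon_less:
  fixes n k :: nat and q :: real
  assumes "0 \<le> q" "q \<le> 1" and small: "2 * (k ^ 3 + k ^ 2 + k) \<le> n ^ CARD('d)"
  shows "measure_pmf.prob (random_grid n q) {\<omega> :: (int ^ 'd) set. max_sidon \<omega> < k}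
    \<le> (real n ^ CARD('d) + 1) ^ k * exp (- q * (real n ^ CARD('d) / 2))"
proof -
  let ?N = "n ^ CARD('d)"
  define I where "I = {S :: (int ^ 'd) set. S \<subseteq> grid n \<and> card S < k \<and> sidon S}"
  define free where "free S = grid n - S - forbidden S" for S :: "(int ^ 'd) set"
  have sub: "I \<subseteq> {S. S \<subseteq> grid n \<and> card S < k}"
    by (auto simp: I_def)
  have fin: "finite {S :: (int ^ 'd) set. S \<subseteq> grid n \<and> card S < k}"
    by (rule finite_subset[of _ "Pow (grid n)"]) (auto simp: finite_grid)
  have cardI: "card I \<le> (?N + 1) ^ k"
    using card_mono[OF fin sub] card_subsets_of_size_less[OF finite_grid[of n, where ?'d = 'd], of k]
    by (simp add: card_grid)
  have "measure_pmf.prob (random_grid n q) {\<omega> :: (int ^ 'd) set. max_sidon \<omega> < k}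
      \<le> real (card I) * exp (- q * (real n ^ CARD('d) / 2))"
  proof (rule prob_union_bound[OF finite_subset[OF sub fin]])
    fix \<omega> :: "(int ^ 'd) set"
    assume \<omega>: "\<omega> \<in> set_pmf (random_grid n q)" "\<omega> \<in> {\<omega>. max_sidon \<omega> < k}"
    have sub: "\<omega> \<subseteq> grid n" "finite \<omega>"
      using set_pmf_random_grid[OF \<omega>(1)] finite_subset[OF _ finite_grid] by auto
    obtain S where S: "S \<subseteq> \<omega>" "sidon S" "card S = max_sidon \<omega>"
      using max_sidon_attained[OF sub(2)] .
    have "S \<in> I"
      using S \<omega>(2) sub(1) by (auto simp: I_def)
    moreover have "x \<in> forbidden S" if "x \<in> \<omega>" "x \<notin> S" for x
    proof (rule ccontr)
      assume "x \<notin> forbidden S"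
      then have "card (insert x S) \<le> max_sidon \<omega>"
        using that S sub by (intro card_le_max_sidon) (auto simp: forbidden_def)
      then show False
        using S that finite_subset[OF S(1) sub(2)] by simp
    qed
    ultimately show "\<exists>S\<in>I. \<omega> \<in> {\<omega>. free S \<inter> \<omega> = {}}"
      by (intro bexI[of _ S]) (auto simp: free_def)
  next
    fix S assume "S \<in> I"
    then have S: "S \<subseteq> grid n" "card S < k" "sidon S" "finite S"
      using finite_subset[OF _ finite_grid] by (auto simp: I_def)
    have forb: "finite (forbidden S)" "card (forbidden S) \<le> card S ^ 3 + card S ^ 2"
      using card_forbidden_le[OF S(3,4)] by auto
    have "?N \<le> card (free S \<union> (S \<union> forbidden S))"
      unfolding card_grid[symmetric, where ?'d = 'd]
      by (rule card_mono) (auto simp: free_def S(4) forb(1) finite_grid)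
    also have "\<dots> \<le> card (free S) + (card S + card (forbidden S))"
      using card_Un_le[of "free S" "S \<union> forbidden S"] card_Un_le[of S "forbidden S"] by linarith
    also have "\<dots> \<le> card (free S) + (k + (k ^ 3 + k ^ 2))"
    proof (intro add_left_mono add_mono)
      show "card (forbidden S) \<le> k ^ 3 + k ^ 2"
        by (rule order_trans[OF forb(2)]) (use S(2) in \<open>intro add_mono power_mono, auto\<close>)
    qed (use S(2) in simp)
    finally have "?N \<le> card (free S) + (k ^ 3 + k ^ 2 + k)"
      by (simp only: ac_simps)
    moreover have "N \<le> 2 * F" if "N \<le> F + X" "2 * X \<le> N" for N F X :: nat
      using that by linarith
    ultimately have "?N \<le> 2 * card (free S)"
      using small by blast
    then have "real n ^ CARD('d) / 2 \<le> real (card (free S))"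
      using of_nat_mono[of ?N "2 * card (free S)", where ?'a = real] by simp
    then have "q * (real n ^ CARD('d) / 2) \<le> q * real (card (free S))"
      using assms(1) by (rule mult_left_mono)
    then show "measure_pmf.prob (random_grid n q) {\<omega>. free S \<inter> \<omega> = {}}
        \<le> exp (- q * (real n ^ CARD('d) / 2))"
      by (intro order_trans[OF prob_random_grid_avoids[of "free S" n q]])
        (use assms in \<open>simp_all add: free_def subset_eq\<close>)
  qed
  also have "\<dots> \<le> (real n ^ CARD('d) + 1) ^ k * exp (- q * (real n ^ CARD('d) / 2))"
  proof (rule mult_right_mono)
    show "real (card I) \<le> (real n ^ CARD('d) + 1) ^ k"
      using of_nat_mono[OF cardI, where ?'a = real] by (simp add: add.commute)
  qed simp
  finally show ?thesis .
qed

section \<open>Containers for Sidon sets\<close>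

text \<open>
  The Kleitman--Winston argument, arranged as a recursion. As long as \<open>U\<close> has more than \<open>R\<close> vertices,
  branch on whether a vertex \<open>v\<close> of large degree lies in the independent set \<open>I\<close>. If it does not, delete
  \<open>v\<close>; if it does, delete all its neighbours too, which shrinks the vertex set by a factor
  \<open>1 - \<beta> \<le> exp (- \<beta>)\<close>. The second branch can therefore be taken at most \<open>j\<close> times, so there are only
  about \<open>card U ^ j\<close> leaves.
\<close>

lemma independent_set_containers:
  fixes E :: "'a \<Rightarrow> 'a \<Rightarrow> bool"
  assumes "finite U"
    and "\<And>W. W \<subseteq> U \<Longrightarrow> real (card W) > R \<Longrightarrow> \<exists>v\<in>W. \<beta> * real (card W) \<le> real (card {w\<in>W. E v w})"
    and "real (card U) \<le> R * exp (\<beta> * real j)"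
  shows "\<exists>\<C>. finite \<C> \<and> card \<C> \<le> (card U + 1) ^ j \<and> (\<forall>C\<in>\<C>. finite C \<and> real (card C) \<le> R + real j) \<and>
           (\<forall>I\<subseteq>U. (\<forall>x\<in>I. \<forall>y\<in>I. \<not> E x y) \<longrightarrow> (\<exists>C\<in>\<C>. I \<subseteq> C))"
  using assms
proof (induction U arbitrary: j rule: finite_psubset_induct)
  case (psubset U)
  show ?case
  proof (cases "real (card U) \<le> R")
    case True
    with psubset.hyps show ?thesis
      by (intro exI[of _ "{U}"]) auto
  next
    case False
    then obtain v where v: "v \<in> U" and deg: "\<beta> * real (card U) \<le> real (card {w\<in>U. E v w})"
      using psubset.prems(1)[of U] by auto
    have "j \<noteq> 0"
      using False psubset.prems(2) by (intro notI) simp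
    then obtain i where j: "j = Suc i"
      using not0_implies_Suc by blast
    define U1 where "U1 = U - {v}"
    define U2 where "U2 = U - {v} - {w\<in>U. E v w}"
    have psub: "U1 \<subset> U" "U2 \<subset> U"
      using v by (auto simp: U1_def U2_def)
    have cardU: "card U = Suc (card U1)"
      unfolding U1_def by (rule card.remove[OF psubset.hyps v])
    have finU: "finite U1" "finite U2"
      using psubset.hyps by (auto simp: U1_def U2_def)
    have card2: "card U2 \<le> card U1"
      using finU by (intro card_mono) (auto simp: U1_def U2_def)
    have "card U2 + card {w\<in>U. E v w} \<le> card U"
      by (subst card_Un_disjoint[symmetric])
        (use psubset.hyps in \<open>auto simp: U2_def intro: card_mono\<close>)
    then have "real (card U2) \<le> (1 - \<beta>) * real (card U)"
      using deg by (simp add: algebra_simps)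
    also have "\<dots> \<le> exp (- \<beta>) * real (card U)"
      using exp_ge_add_one_self[of "- \<beta>"] by (intro mult_right_mono) auto
    also have "\<dots> \<le> exp (- \<beta>) * (R * exp (\<beta> * real j))"
      using psubset.prems(2) by (intro mult_left_mono) auto
    also have "\<dots> = R * exp (\<beta> * real i)"
      by (simp add: j algebra_simps exp_add exp_minus)
    finally have small2: "real (card U2) \<le> R * exp (\<beta> * real i)" .
    have small1: "real (card U1) \<le> R * exp (\<beta> * real j)"
      using psubset.prems(2) cardU by simp
    obtain C1 where C1: "finite C1" "card C1 \<le> (card U1 + 1) ^ j"
        "\<forall>C\<in>C1. finite C \<and> real (card C) \<le> R + real j"
        "\<forall>I\<subseteq>U1. (\<forall>x\<in>I. \<forall>y\<in>I. \<not> E x y) \<longrightarrow> (\<exists>C\<in>C1. I \<subseteq> C)"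
      using psubset.IH[OF psub(1) psubset.prems(1) small1] psub(1) by blast
    obtain C2 where C2: "finite C2" "card C2 \<le> (card U2 + 1) ^ i"
        "\<forall>C\<in>C2. finite C \<and> real (card C) \<le> R + real i"
        "\<forall>I\<subseteq>U2. (\<forall>x\<in>I. \<forall>y\<in>I. \<not> E x y) \<longrightarrow> (\<exists>C\<in>C2. I \<subseteq> C)"
      using psubset.IH[OF psub(2) psubset.prems(1) small2] psub(2) by blast
    show ?thesis
    proof (intro exI[of _ "C1 \<union> insert v ` C2"] conjI ballI allI impI)
      show "finite (C1 \<union> insert v ` C2)"
        using C1 C2 by simp
      have "card (C1 \<union> insert v ` C2) \<le> card C1 + card C2"
        using card_Un_le[of C1 "insert v ` C2"] card_image_le[OF C2(1), of "insert v"] by linarith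
      also have "\<dots> \<le> card U ^ j + card U ^ i"
        using C1(2) C2(2) card2 power_mono[of "card U2 + 1" "card U" i] cardU
        by (intro add_mono) (auto intro: order_trans)
      also have "\<dots> = card U ^ i * (card U + 1)"
        by (simp add: j)
      also have "\<dots> \<le> (card U + 1) ^ i * (card U + 1)"
        by (intro mult_right_mono power_mono) auto
      finally show "card (C1 \<union> insert v ` C2) \<le> (card U + 1) ^ j"
        by (simp add: j mult.commute)
    next
      fix C assume "C \<in> C1 \<union> insert v ` C2"
      then have "finite C \<and> real (card C) \<le> R + real j"
      proof
        assume "C \<in> insert v ` C2"
        then obtain D where D: "D \<in> C2" "C = insert v D"
          by blast
        then have "finite D" "real (card D) \<le> R + real i"
          using C2(3) by auto
        moreover have "card (insert v D) \<le> Suc (card D)"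
          by (rule card_insert_le_m1) auto
        ultimately show ?thesis
          by (auto simp: D(2) j)
      qed (use C1(3) in blast)
      then show "finite C" "real (card C) \<le> R + real j"
        by blast+
    next
      fix I assume I: "I \<subseteq> U" "\<forall>x\<in>I. \<forall>y\<in>I. \<not> E x y"
      show "\<exists>C\<in>C1 \<union> insert v ` C2. I \<subseteq> C"
      proof (cases "v \<in> I")
        case False
        then show ?thesis
          using C1(4)[rule_format, of I] I by (auto simp: U1_def)
      next
        case True
        then have "I - {v} \<subseteq> U2" "\<forall>x\<in>I - {v}. \<forall>y\<in>I - {v}. \<not> E x y"
          using I by (auto simp: U2_def)
        then obtain C where "C \<in> C2" "I - {v} \<subseteq> C"
          using C2(4) by blast
        then show ?thesis
          by (intro bexI[of _ "insert v C"]) auto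
      qed
    qed
  qed
qed

text \<open>
  The Cauchy--Schwarz inequality for the fibre sizes of \<open>f\<close>.
\<close>

lemma card_equal_pairs_ge:
  assumes "finite P" "finite T" "f ` P \<subseteq> T"
  shows "(card P)\<^sup>2 \<le> card {(u, v). u \<in> P \<and> v \<in> P \<and> f u = f v} * card T"
proof -
  let ?F = "\<lambda>t. {u\<in>P. f u = t}"
  have P: "P = (\<Union>t\<in>T. ?F t)"
    using assms by auto
  have cP: "card P = (\<Sum>t\<in>T. card (?F t))"
    by (subst P, rule card_UN_disjoint) (use assms in auto)
  have Q: "{(u, v). u \<in> P \<and> v \<in> P \<and> f u = f v} = (\<Union>t\<in>T. ?F t \<times> ?F t)"
    using assms by auto
  have "card {(u, v). u \<in> P \<and> v \<in> P \<and> f u = f v} = (\<Sum>t\<in>T. card (?F t \<times> ?F t))"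
    unfolding Q by (rule card_UN_disjoint) (use assms in auto)
  also have "\<dots> = (\<Sum>t\<in>T. (card (?F t))\<^sup>2)"
    by (simp add: card_cartesian_product power2_eq_square)
  finally have cQ: "card {(u, v). u \<in> P \<and> v \<in> P \<and> f u = f v} = (\<Sum>t\<in>T. (card (?F t))\<^sup>2)" .
  have "(\<Sum>t\<in>T. real (card (?F t)))\<^sup>2 \<le> (\<Sum>t\<in>T. (real (card (?F t)))\<^sup>2) * real (card T)"
    by (rule sum_squared_le_sum_of_squares)
  then have "real ((card P)\<^sup>2) \<le> real (card {(u, v). u \<in> P \<and> v \<in> P \<and> f u = f v} * card T)"
    unfolding cQ cP by simp
  then show ?thesis
    by linarith
qed

text \<open>
  A Sidon set that contains \<open>S\<close> cannot contain two points outside \<open>S\<close> that collide.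
\<close>

definition collide :: "'a::ab_semigroup_add set \<Rightarrow> 'a \<Rightarrow> 'a \<Rightarrow> bool" where
  "collide S x y \<longleftrightarrow> x \<noteq> y \<and> (\<exists>a\<in>S. \<exists>b\<in>S. x + a = y + b)"

text \<open>
  The \<open>card W * card S\<close> sums of a point of \<open>W\<close> and a point of \<open>S\<close> all lie in the grid of side \<open>2 n\<close>, so
  by Cauchy--Schwarz many of them coincide. Every coincidence with distinct first points is an edge of
  the collision graph on \<open>W\<close>, and no edge is counted twice because \<open>S\<close> is a Sidon set. Hence the average
  degree is large.
\<close>

lemma collide_degree:
  fixes S W :: "(int ^ 'd) set"
  assumes "sidon S" "S \<subseteq> grid n" "W \<subseteq> grid n" "W \<noteq> {}"
    and large: "2 * (2 * n) ^ CARD('d) \<le> card W * card S"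
  shows "\<exists>v\<in>W. (real (card S))\<^sup>2 / (2 * real ((2 * n) ^ CARD('d))) * real (card W)
                 \<le> real (card {w\<in>W. collide S v w})"
proof (rule ccontr)
  define G where "G = (2 * n) ^ CARD('d)"
  define P where "P = W \<times> S"
  define Q where "Q = {(u, v). u \<in> P \<and> v \<in> P \<and> fst u + snd u = fst v + snd v}"
  define Q' where "Q' = {(u, v). (u, v) \<in> Q \<and> fst u \<noteq> fst v}"
  define L where "L = (SIGMA v:W. {w\<in>W. collide S v w})"
  have fin: "finite W" "finite S" "finite P"
    using assms finite_subset[OF _ finite_grid] unfolding P_def by blast+
  have finQ: "finite Q"
    by (rule finite_subset[of _ "P \<times> P"]) (use fin in \<open>auto simp: Q_def\<close>)
  have cP: "card P = card W * card S"
    by (simp add: P_def card_cartesian_product)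
  have sums: "x + y \<in> grid (2 * n)" if "x \<in> grid n" "y \<in> grid n" for x y :: "int ^ 'd"
  proof -
    have "0 \<le> x $ i" "x $ i \<le> int n - 1" "0 \<le> y $ i" "y $ i \<le> int n - 1" for i
      using that by (auto simp: grid_def)
    then show ?thesis
      unfolding grid_def by (auto, smt (verit))
  qed
  have "(card P)\<^sup>2 \<le> card Q * card (grid (2 * n) :: (int ^ 'd) set)"
    unfolding Q_def using card_equal_pairs_ge[of P "grid (2 * n)" "\<lambda>u. fst u + snd u"] fin(3) finite_grid
      sums assms(2,3) by (force simp: P_def)
  then have many: "(card P)\<^sup>2 \<le> card Q * G"
    by (simp add: card_grid G_def)
  \<comment> \<open>Solutions with equal first entries are trivial by cancellation.\<close>
  have "Q \<subseteq> (\<lambda>u. (u, u)) ` P \<union> Q'"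
    by (auto simp: Q_def Q'_def)
  then have "card Q \<le> card ((\<lambda>u. (u, u)) ` P \<union> Q')"
    using fin finQ by (intro card_mono) (auto simp: Q'_def intro: finite_subset[OF _ finQ])
  also have "\<dots> \<le> card P + card Q'"
    using card_Un_le card_image_le[OF fin(3)] by (meson add_mono order.trans order_refl)
  finally have QQ': "card Q \<le> card P + card Q'" .
  \<comment> \<open>A nonzero difference of two elements of the Sidon set \<open>S\<close> determines both elements, so a
    solution is determined by the edge that it witnesses.\<close>
  have inj: "inj_on (\<lambda>(u, v). (fst u, fst v)) Q'"
  proof (rule inj_onI, clarsimp simp: Q'_def Q_def P_def)
    fix x y a b a' b'
    assume *: "x \<noteq> y" "x + a = y + b" "x + a' = y + b'" "a \<in> S" "b \<in> S" "a' \<in> S" "b' \<in> S"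
    have "a + b' = a' + b"
    proof -
      have "(x + a) + (y + b') = (y + b) + (x + a')"
        using *(2,3) by simp
      then show ?thesis
        by (simp add: algebra_simps)
    qed
    then have "{a, b'} = {a', b}"
      using sidonD[OF assms(1)] * by blast
    moreover have "a \<noteq> b"
      using *(1,2) by (metis add_right_cancel)
    ultimately show "a = a' \<and> b = b'"
      by (auto simp: doubleton_eq_iff)
  qed
  have "card Q' = card ((\<lambda>(u, v). (fst u, fst v)) ` Q')"
    using card_image[OF inj] by simp
  also have "\<dots> \<le> card L"
    by (rule card_mono) (use fin in \<open>auto simp: L_def Q'_def Q_def P_def collide_def, blast\<close>)
  also have "\<dots> = (\<Sum>v\<in>W. card {w\<in>W. collide S v w})"
    unfolding L_def using fin by (simp add: card_SigmaI)
  finally have "real (card Q') \<le> (\<Sum>v\<in>W. real (card {w\<in>W. collide S v w}))"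
    unfolding of_nat_sum[symmetric] by (rule of_nat_mono)
  moreover assume no: "\<not> ?thesis"
  then have "(\<Sum>v\<in>W. real (card {w\<in>W. collide S v w}))
      < (\<Sum>v\<in>W. (real (card S))\<^sup>2 / (2 * real G) * real (card W))"
    by (intro sum_strict_mono) (use assms(4) fin in \<open>auto simp: G_def not_le\<close>)
  ultimately have less: "real (card Q') < (real (card P))\<^sup>2 / (2 * real G)"
    by (simp add: cP power2_eq_square mult_ac)
  then have "G > 0"
    by (cases "G = 0") auto
  have "real (card P) ^ 2 \<le> real (card Q) * real G"
    using of_nat_mono[OF many, where ?'a = real] by simp
  also have "\<dots> \<le> (real (card P) + real (card Q')) * real G"
    using QQ' by (intro mult_right_mono) linarith+
  also have "\<dots> < real (card P) * real G + (real (card P))\<^sup>2 / 2"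
    using less \<open>G > 0\<close> by (simp add: field_simps)
  finally have "real (card P) * real (card P) < real (card P) * (2 * real G)"
    by (simp add: power2_eq_square)
  moreover have "2 * real G \<le> real (card P)"
    using of_nat_mono[OF large, where ?'a = real] unfolding cP G_def[symmetric] by simp
  ultimately show False
    by (smt (verit) mult_left_mono of_nat_0_le_iff)
qed

text \<open>
  A Sidon set with at least \<open>s\<close> points contains a Sidon set \<open>S0\<close> with exactly \<open>s\<close> points, and the rest of
  it is independent in the collision graph of \<open>S0\<close>. That graph is dense on every vertex set of size
  \<open>2 G / s\<close>, so the rest lies in one of few sets of about this size. The hypothesis \<open>enough\<close> says that \<open>j\<close>
  shrinking steps suffice to get from the full grid down to \<open>2 G / s\<close> points.
\<close>

theorem sidon_containers:
  fixes n s j :: nat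
  defines "G \<equiv> real ((2 * n) ^ CARD('d))"
  assumes "s > 0" and "n > 0" and enough: "real s \<le> exp ((real s)\<^sup>2 / (2 * G) * real j)"
  shows "\<exists>\<C> :: (int ^ 'd) set set. finite \<C> \<and> card \<C> \<le> (n ^ CARD('d) + 1) ^ (s + j) \<and>
           (\<forall>C\<in>\<C>. finite C \<and> real (card C) \<le> 2 * G / real s + real j + real s) \<and>
           (\<forall>S\<subseteq>grid n. sidon S \<longrightarrow> s \<le> card S \<longrightarrow> (\<exists>C\<in>\<C>. S \<subseteq> C))"
proof -
  define Y where "Y = {S :: (int ^ 'd) set. S \<subseteq> grid n \<and> card S = s \<and> sidon S}"
  let ?N = "n ^ CARD('d)"
  have "G > 0"
    using \<open>n > 0\<close> by (simp add: G_def)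
  have finY: "finite Y"
    by (rule finite_subset[of _ "Pow (grid n)"]) (auto simp: Y_def finite_grid)
  have "card Y \<le> card {S :: (int ^ 'd) set. S \<subseteq> grid n \<and> card S = s}"
    by (rule card_mono) (auto simp: Y_def finite_grid intro: finite_subset[of _ "Pow (grid n)"])
  also have "\<dots> \<le> ?N ^ s"
    using card_subsets_of_size_le[OF finite_grid] by (metis card_grid)
  also have "\<dots> \<le> (?N + 1) ^ s"
    by (rule power_mono) auto
  finally have cardY: "card Y \<le> (?N + 1) ^ s" .
  have "\<exists>\<C>. finite \<C> \<and> card \<C> \<le> (?N + 1) ^ j \<and>
           (\<forall>C\<in>\<C>. finite C \<and> real (card C) \<le> 2 * G / real s + real j) \<and>
           (\<forall>I\<subseteq>grid n. (\<forall>x\<in>I. \<forall>y\<in>I. \<not> collide S x y) \<longrightarrow> (\<exists>C\<in>\<C>. I \<subseteq> C))"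
    if "S \<in> Y" for S :: "(int ^ 'd) set"
  proof -
    have S: "S \<subseteq> grid n" "card S = s" "sidon S"
      using that by (auto simp: Y_def)
    have dense: "\<exists>v\<in>W. (real s)\<^sup>2 / (2 * G) * real (card W) \<le> real (card {w\<in>W. collide S v w})"
      if W: "W \<subseteq> grid n" "real (card W) > 2 * G / real s" for W
    proof -
      have "2 * G < real (card W) * real s"
        using W(2) \<open>s > 0\<close> by (simp add: field_simps)
      then have "2 * (2 * n) ^ CARD('d) \<le> card W * card S"
        unfolding S(2) G_def by (metis less_imp_le of_nat_le_iff of_nat_mult of_nat_numeral)
      moreover have "W \<noteq> {}"
        using W(2) \<open>G > 0\<close> \<open>s > 0\<close> by (auto simp: divide_less_0_iff)
      ultimately show ?thesis
        using collide_degree[OF S(3,1) W(1)] unfolding S(2) G_def by blast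
    qed
    have "real ?N * real s \<le> G * exp ((real s)\<^sup>2 / (2 * G) * real j)"
    proof (rule mult_mono)
      show "real ?N \<le> G"
        unfolding G_def by (intro of_nat_mono power_mono) auto
    qed (use enough \<open>G > 0\<close> in auto)
    also have "\<dots> \<le> 2 * G * exp ((real s)\<^sup>2 / (2 * G) * real j)"
      using \<open>G > 0\<close> by (intro mult_right_mono) auto
    finally have "real (card (grid n :: (int ^ 'd) set)) \<le> 2 * G / real s * exp ((real s)\<^sup>2 / (2 * G) * real j)"
      using \<open>s > 0\<close> by (simp add: card_grid field_simps)
    then show ?thesis
      using independent_set_containers[where U = "grid n" and E = "collide S" and R = "2 * G / real s"
          and \<beta> = "(real s)\<^sup>2 / (2 * G)" and j = j]
        finite_grid[of n, where ?'d = 'd] dense \<open>G > 0\<close> unfolding card_grid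
      by (simp del: of_nat_power)
  qed
  then obtain \<D> where \<D>: "\<And>S :: (int ^ 'd) set. S \<in> Y \<Longrightarrow> finite (\<D> S) \<and> card (\<D> S) \<le> (?N + 1) ^ j \<and>
           (\<forall>C\<in>\<D> S. finite C \<and> real (card C) \<le> 2 * G / real s + real j) \<and>
           (\<forall>I\<subseteq>grid n. (\<forall>x\<in>I. \<forall>y\<in>I. \<not> collide S x y) \<longrightarrow> (\<exists>C\<in>\<D> S. I \<subseteq> C))"
    by metis
  define \<C> where "\<C> = (\<Union>S\<in>Y. (\<union>) S ` \<D> S)"
  show ?thesis
  proof (intro exI[of _ \<C>] conjI ballI allI impI)
    show "finite \<C>"
      using finY \<D> by (auto simp: \<C>_def)
    have "card \<C> \<le> (\<Sum>S\<in>Y. card ((\<union>) S ` \<D> S))"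
      unfolding \<C>_def by (rule card_UN_le[OF finY])
    also have "\<dots> \<le> (\<Sum>S\<in>Y. (?N + 1) ^ j)"
      by (rule sum_mono) (use \<D> card_image_le in \<open>meson order_trans\<close>)
    also have "\<dots> \<le> (?N + 1) ^ s * (?N + 1) ^ j"
      using cardY by simp
    finally show "card \<C> \<le> (?N + 1) ^ (s + j)"
      by (simp add: power_add)
  next
    fix C assume "C \<in> \<C>"
    then obtain S D where C: "S \<in> Y" "D \<in> \<D> S" "C = S \<union> D"
      by (auto simp: \<C>_def)
    then have D: "finite D" "real (card D) \<le> 2 * G / real s + real j" and S: "finite S" "card S = s"
      using \<D>[OF C(1)] finite_subset[OF _ finite_grid] by (auto simp: Y_def)
    show "finite C"
      using C D S by simp
    show "real (card C) \<le> 2 * G / real s + real j + real s"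
      using card_Un_le[of S D] D(2) S(2) unfolding C(3) by simp
  next
    fix S :: "(int ^ 'd) set" assume S: "S \<subseteq> grid n" "sidon S" "s \<le> card S"
    obtain S0 where S0: "S0 \<subseteq> S" "card S0 = s" "finite S0"
      using obtain_subset_with_card_n[OF S(3)] by blast
    then have Y: "S0 \<in> Y"
      using S sidon_subset by (auto simp: Y_def)
    have "\<not> collide S0 x y" if "x \<in> S - S0" "y \<in> S - S0" for x y
    proof
      assume "collide S0 x y"
      then obtain a b where "a \<in> S0" "b \<in> S0" "x + a = y + b" "x \<noteq> y"
        by (auto simp: collide_def)
      then show False
        using sidonD[OF S(2), of x a y b] that S0(1) by (auto simp: doubleton_eq_iff)
    qed
    then obtain C where "C \<in> \<D> S0" "S - S0 \<subseteq> C"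
      using \<D>[OF Y] S(1) by (meson Diff_subset order_trans)
    then show "\<exists>C\<in>\<C>. S \<subseteq> C"
      unfolding \<C>_def using Y by (intro bexI[of _ "S0 \<union> C"]) auto
  qed
qed

lemma prob_max_sidon_ge:
  fixes n s j m :: nat and q :: real
  defines "G \<equiv> real ((2 * n) ^ CARD('d))"
  assumes "s > 0" "n > 0" "s \<le> m" "0 \<le> q" "q \<le> 1"
    and enough: "real s \<le> exp ((real s)\<^sup>2 / (2 * G) * real j)"
  shows "measure_pmf.prob (random_grid n q) {\<omega> :: (int ^ 'd) set. m \<le> max_sidon \<omega>}
    \<le> (real n ^ CARD('d) + 1) ^ (s + j) * (exp 1 * (2 * G / real s + real j + real s) * q / real m) ^ m"
proof -
  let ?N = "n ^ CARD('d)"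
  let ?B = "(exp 1 * (2 * G / real s + real j + real s) * q / real m) ^ m"
  obtain \<C> :: "(int ^ 'd) set set" where \<C>: "finite \<C>" "card \<C> \<le> (?N + 1) ^ (s + j)"
      "\<forall>C\<in>\<C>. finite C \<and> real (card C) \<le> 2 * G / real s + real j + real s"
      "\<forall>S\<subseteq>grid n. sidon S \<longrightarrow> s \<le> card S \<longrightarrow> (\<exists>C\<in>\<C>. S \<subseteq> C)"
    using sidon_containers[OF assms(2,3) enough[unfolded G_def]] unfolding G_def by blast
  have "measure_pmf.prob (random_grid n q) {\<omega> :: (int ^ 'd) set. m \<le> max_sidon \<omega>} \<le> real (card \<C>) * ?B"
  proof (rule prob_union_bound[OF \<C>(1)])
    fix \<omega> :: "(int ^ 'd) set"
    assume \<omega>: "\<omega> \<in> set_pmf (random_grid n q)" "\<omega> \<in> {\<omega>. m \<le> max_sidon \<omega>}"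
    then have sub: "\<omega> \<subseteq> grid n" "finite \<omega>"
      using set_pmf_random_grid[OF \<omega>(1)] finite_subset[OF _ finite_grid] by auto
    obtain S where S: "S \<subseteq> \<omega>" "sidon S" "card S = max_sidon \<omega>"
      using max_sidon_attained[OF sub(2)] .
    have "S \<subseteq> grid n" "s \<le> card S"
      using S(1,3) sub(1) \<omega>(2) \<open>s \<le> m\<close> by auto
    then obtain C where C: "C \<in> \<C>" "S \<subseteq> C"
      using \<C>(4) S(2) by blast
    obtain S' where "S' \<subseteq> S" "card S' = m"
      using obtain_subset_with_card_n[of m S] S(3) \<omega>(2) by auto
    then show "\<exists>C\<in>\<C>. \<omega> \<in> {\<omega>. \<exists>S. S \<subseteq> \<omega> \<inter> C \<and> card S = m}"
      using S(1) C by blast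
  next
    fix C assume C: "C \<in> \<C>"
    have "measure_pmf.prob (random_grid n q) {\<omega>. \<exists>S. S \<subseteq> \<omega> \<inter> C \<and> card S = m}
          \<le> (exp 1 * real (card C) * q / real m) ^ m"
      by (rule prob_random_grid_large_intersection) (use C \<C>(3) assms in auto)
    also have "\<dots> \<le> ?B"
      using C \<C>(3) assms by (intro power_mono divide_right_mono mult_right_mono mult_left_mono) auto
    finally show "measure_pmf.prob (random_grid n q) {\<omega>. \<exists>S. S \<subseteq> \<omega> \<inter> C \<and> card S = m} \<le> ?B" .
  qed
  also have "\<dots> \<le> (real n ^ CARD('d) + 1) ^ (s + j) * ?B"
  proof (rule mult_right_mono)
    show "real (card \<C>) \<le> (real n ^ CARD('d) + 1) ^ (s + j)"
      using of_nat_mono[OF \<C>(2), where ?'a = real] by (simp add: add.commute)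
    show "0 \<le> ?B"
      using assms by (auto simp: G_def)
  qed
  finally show ?thesis .
qed

section \<open>Existence of primes of nearly prescribed size\<close>

text \<open>
  Equivalently, \<open>Lcm {1..n}\<close> times the entry \<open>1 / (m * (n choose m))\<close> of the Leibniz harmonic triangle is
  an integer. Every entry is a difference of two entries, one from the row above and one from the left,
  and the first column consists of the numbers \<open>1 / n\<close>.
\<close>

lemma choose_times_dvd_Lcm:
  assumes "1 \<le> m" "m \<le> n"
  shows "m * (n choose m) dvd Lcm {1..n}"
  using assms
proof (induction n arbitrary: m)
  case (Suc n)
  have Lcm_dvd: "Lcm {1..n} dvd Lcm {1..Suc n}"
    by (rule Lcm_subset) auto
  show ?case
    using Suc.prems
  proof (induction m rule: dec_induct)
    case base
    then show ?case
      by (simp add: dvd_Lcm)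
  next
    case (step m)
    then have m: "1 \<le> m" "m \<le> n"
      by auto
    \<comment> \<open>The Leibniz harmonic triangle: \<open>1 / ((m+1) C(n+1, m+1)) = 1 / (m C(n, m)) - 1 / (m C(n+1, m))\<close>.\<close>
    let ?L = "real (Lcm {1..Suc n})"
    obtain u where u: "Lcm {1..Suc n} = m * (n choose m) * u"
      using Suc.IH[OF m] Lcm_dvd by (meson dvd_trans dvdE)
    obtain v where v: "Lcm {1..Suc n} = m * (Suc n choose m) * v"
      using step by auto
    have Lu: "?L = real m * (real (n choose m) * real u)"
      using arg_cong[OF u, of real] by (simp only: of_nat_mult mult.assoc)
    have Lv: "?L = real m * (real (Suc n choose m) * real v)"
      using arg_cong[OF v, of real] by (simp only: of_nat_mult mult.assoc)
    have pos: "real m > 0" "real (n choose m) > 0" "real (Suc n choose m) > 0"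
      using m by auto
    have absorb: "real (Suc m) * real (Suc n choose Suc m) = real (Suc n - m) * real (Suc n choose m)"
      by (metis Suc_times_binomial binomial_absorb_comp diff_Suc_1 of_nat_mult)
    have comp: "real (Suc n - m) * real (Suc n choose m) = real (Suc n) * real (n choose m)"
      by (metis binomial_absorb_comp diff_Suc_1 of_nat_mult)
    have "real (Suc m * (Suc n choose Suc m)) * (real u - real v) = ?L"
    proof -
      have "real (Suc m * (Suc n choose Suc m)) * (real u - real v)
          = real (Suc n) * (real (n choose m) * real u) - real (Suc n - m) * (real (Suc n choose m) * real v)"
      proof -
        have "real (Suc m * (Suc n choose Suc m)) * (real u - real v)
            = (real (Suc m) * real (Suc n choose Suc m)) * real u - (real (Suc m) * real (Suc n choose Suc m)) * real v"
          by (simp only: of_nat_mult right_diff_distrib)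
        also have "\<dots> = (real (Suc n) * real (n choose m)) * real u - (real (Suc n - m) * real (Suc n choose m)) * real v"
          by (simp only: absorb comp)
        finally show ?thesis
          by (simp only: mult.assoc)
      qed
      also have "real (n choose m) * real u = ?L / real m"
        unfolding Lu using pos by simp
      also have "real (Suc n choose m) * real v = ?L / real m"
        unfolding Lv using pos by simp
      also have "real (Suc n) * (?L / real m) - real (Suc n - m) * (?L / real m) = ?L"
        using m pos by (simp add: field_simps of_nat_diff)
      finally show ?thesis .
    qed
    then have "int (Suc m * (Suc n choose Suc m)) * (int u - int v) = int (Lcm {1..Suc n})"
      by (metis (mono_tags, opaque_lifting) of_int_diff of_int_eq_iff of_int_mult of_int_of_nat_eq)
    then show ?case
      by (metis dvd_triv_left int_dvd_int_iff)
  qed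
qed simp

text \<open>
  A prime power that divides \<open>Lcm {1..n}\<close> divides one of \<open>1, ..., n\<close> and is thus at most \<open>n\<close>, and
  there are at most \<open>y\<close> primes to consider.
\<close>

lemma Lcm_le_power_of_prime_bound:
  assumes "\<And>q. prime q \<Longrightarrow> q \<le> n \<Longrightarrow> q \<le> y" and "n \<ge> 1"
  shows "Lcm {1..n} \<le> n ^ y"
proof -
  let ?L = "Lcm {1..n} :: nat"
  have L: "?L \<noteq> 0"
    by (simp add: Lcm_0_iff)
  have mult_le: "k \<ge> 1 \<Longrightarrow> prime q \<Longrightarrow> q ^ multiplicity q (Lcm {1..k}) \<le> k" for q k :: nat
  proof (induction k rule: nat_induct_at_least)
    case base
    then show ?case by simp
  next
    case (Suc k)
    have "Lcm {1..Suc k} = lcm (Suc k) (Lcm {1..k})"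
      using Suc.hyps by (simp add: atLeastAtMostSuc_conv)
    moreover have "multiplicity q (lcm (Suc k) (Lcm {1..k})) = max (multiplicity q (Suc k)) (multiplicity q (Lcm {1..k}))"
      by (rule multiplicity_lcm) (use Suc.prems in \<open>auto simp: Lcm_0_iff\<close>)
    moreover have "q ^ multiplicity q (Suc k) \<le> Suc k"
      by (intro dvd_imp_le multiplicity_dvd) simp
    ultimately show ?case
      using Suc.IH Suc.prems by (auto simp: max_def)
  qed
  have factors: "prime_factors ?L \<subseteq> {1..y}"
  proof
    fix q assume q: "q \<in> prime_factors ?L"
    then have pq: "prime q" "q dvd ?L"
      by auto
    have "multiplicity q ?L \<ge> 1"
      using pq L by (simp add: Suc_le_eq prime_multiplicity_gt_zero_iff)
    then have "q ^ 1 \<le> q ^ multiplicity q ?L"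
      using prime_ge_1_nat[OF pq(1)] by (intro power_increasing) auto
    then have "q \<le> n"
      using mult_le[OF assms(2) pq(1)] by simp
    then show "q \<in> {1..y}"
      using assms(1) pq(1) prime_ge_1_nat by auto
  qed
  have "?L = (\<Prod>q\<in>prime_factors ?L. q ^ multiplicity q ?L)"
    by (rule prime_factorization_nat) (use L in blast)
  also have "\<dots> \<le> (\<Prod>q\<in>prime_factors ?L. n)"
    by (rule prod_mono) (use mult_le assms(2) in auto)
  also have "\<dots> = n ^ card (prime_factors ?L)"
    by simp
  also have "\<dots> \<le> n ^ y"
    using card_mono[OF _ factors] assms(2) by (intro power_increasing) auto
  finally show ?thesis .
qed

lemma two_power_le_of_prime_bound:
  assumes "\<And>q. prime q \<Longrightarrow> q \<le> n \<Longrightarrow> q \<le> y" and "n \<ge> 1"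
  shows "2 ^ n \<le> (n + 1) * n ^ y"
proof -
  let ?L = "Lcm {1..n} :: nat"
  have L: "?L > 0"
    by (metis Lcm_0_iff atLeastAtMost_iff finite_atLeastAtMost not_gr_zero not_one_le_zero)
  have "n choose m \<le> ?L" if "m \<le> n" for m
  proof (cases "m = 0")
    case True
    then show ?thesis using L by simp
  next
    case False
    then have "n choose m dvd ?L"
      using choose_times_dvd_Lcm[of m n] that by (metis One_nat_def Suc_leI dvd_mult_right not_gr_zero)
    then show ?thesis
      using L by (rule dvd_imp_le)
  qed
  then have "(\<Sum>m\<le>n. n choose m) \<le> (\<Sum>m\<le>n. ?L)"
    by (intro sum_mono) auto
  then have "2 ^ n \<le> (n + 1) * ?L"
    by (simp add: choose_row_sum)
  also have "\<dots> \<le> (n + 1) * n ^ y"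
    using Lcm_le_power_of_prime_bound[OF assms] by (rule mult_left_mono) auto
  finally show ?thesis .
qed

text \<open>
  A weak form of Bertrand's postulate that is enough for exponents: otherwise
  \<open>two_power_le_of_prime_bound\<close> with \<open>y = n powr (1 - \<delta>)\<close> would bound \<open>2 ^ n\<close> by
  \<open>(n + 1) * n ^ y\<close>, which is subexponential.
\<close>

lemma eventually_prime_ge_powr:
  fixes \<delta> :: real
  assumes "\<delta> > 0"
  shows "\<forall>\<^sub>F n in at_top. \<exists>q. prime q \<and> q \<le> n \<and> real n powr (1 - \<delta>) < real q"
proof -
  have "\<forall>\<^sub>F n :: nat in at_top. ln (real n + 1) < real n * (1 / 3)"
    by real_asymp
  moreover have "\<forall>\<^sub>F n :: nat in at_top. real n powr (1 - \<delta>) * ln (real n) < real n * (1 / 3)"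
    using assms by real_asymp
  moreover have "\<forall>\<^sub>F n :: nat in at_top. n \<ge> 1"
    by (rule eventually_ge_at_top)
  ultimately show ?thesis
  proof eventually_elim
    case (elim n)
    show ?case
    proof (rule ccontr)
      assume *: "\<not> ?thesis"
      define y where "y = nat \<lfloor>real n powr (1 - \<delta>)\<rfloor>"
      have "2 ^ n \<le> (n + 1) * n ^ y"
      proof (rule two_power_le_of_prime_bound)
        fix q :: nat assume "prime q" "q \<le> n"
        then have "real q \<le> real n powr (1 - \<delta>)"
          using * not_less by blast
        then show "q \<le> y"
          unfolding y_def by (simp add: le_nat_floor)
      qed (use elim in simp)
      then have "real (2 ^ n) \<le> real ((n + 1) * n ^ y)"
        by (rule of_nat_mono)
      then have "2 ^ n \<le> (real n + 1) * real n ^ y"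
        by (simp add: algebra_simps)
      moreover have "0 < (real n + 1) * real n ^ y"
        using elim by (intro mult_pos_pos) auto
      ultimately have "ln (2 ^ n) \<le> ln ((real n + 1) * real n ^ y)"
        by (subst ln_le_cancel_iff) auto
      also have "\<dots> = ln (real n + 1) + real y * ln (real n)"
        using elim by (simp add: ln_mult ln_realpow)
      also have "real y * ln (real n) \<le> real n powr (1 - \<delta>) * ln (real n)"
        using elim by (intro mult_right_mono) (auto simp: y_def)
      also have "ln (real n + 1) + real n powr (1 - \<delta>) * ln (real n) < real n * (2 / 3)"
        using elim by simp
      also have "real n * (2 / 3) \<le> real n * ln 2"
        using ln2_ge_two_thirds by (intro mult_left_mono) auto
      finally show False
        by (simp add: ln_realpow)
    qed
  qed
qed

section \<open>The Erdos--Turan construction\<close>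

text \<open>
  The set consists of the numbers \<open>2 q k + (k\<^sup>2 mod q)\<close> with \<open>0 \<le> k < q\<close>. The sum of two of them
  determines \<open>k + l\<close> and, modulo \<open>q\<close>, also \<open>k\<^sup>2 + l\<^sup>2\<close>; over the field with \<open>q\<close> elements these two
  values determine the unordered pair.
\<close>

lemma erdos_turan_sidon:
  fixes q :: nat
  assumes "prime q" "odd q"
  shows "\<exists>A :: int set. A \<subseteq> {0..<2 * (int q)\<^sup>2} \<and> sidon A \<and> card A = q"
proof -
  define f where "f k = 2 * int q * k + k\<^sup>2 mod int q" for k
  have q: "int q > 0"
    using assms(1) prime_gt_0_nat by simp
  have r: "0 \<le> x mod int q" "x mod int q < int q" for x
    using q by auto
  \<comment> \<open>The residues add up to less than \<open>2 q\<close>, so there is no carry.\<close>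
  have split: "k + l = k' + l' \<and> (k\<^sup>2 + l\<^sup>2) mod int q = (k'\<^sup>2 + l'\<^sup>2) mod int q"
    if "f k + f l = f k' + f l'" for k l k' l'
  proof -
    have f2: "f k + f l = 2 * int q * (k + l) + (k\<^sup>2 mod int q + l\<^sup>2 mod int q)" for k l
      by (simp add: f_def algebra_simps)
    have R: "0 \<le> k\<^sup>2 mod int q + l\<^sup>2 mod int q" "k\<^sup>2 mod int q + l\<^sup>2 mod int q < 2 * int q" for k l
      using r[of "k\<^sup>2"] r[of "l\<^sup>2"] by linarith+
    have "(f k + f l) div (2 * int q) = k + l" "(f k + f l) mod (2 * int q) = k\<^sup>2 mod int q + l\<^sup>2 mod int q" for k l
      using int_div_pos_eq[OF f2 R] int_mod_pos_eq[OF f2 R] by blast+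
    then have "k + l = k' + l'" "k\<^sup>2 mod int q + l\<^sup>2 mod int q = k'\<^sup>2 mod int q + l'\<^sup>2 mod int q"
      using that by metis+
    then show ?thesis
      by (metis mod_add_eq)
  qed
  have sid: "{k, l} = {k', l'}"
    if eq: "f k + f l = f k' + f l'" and mem: "k \<in> {0..<int q}" "l \<in> {0..<int q}" "k' \<in> {0..<int q}" "l' \<in> {0..<int q}"
    for k l k' l'
  proof -
    have s: "k + l = k' + l'" and m: "(k\<^sup>2 + l\<^sup>2) mod int q = (k'\<^sup>2 + l'\<^sup>2) mod int q"
      using split[OF eq] by auto
    have l: "l = k' + l' - k"
      using s by simp
    have "int q dvd (k\<^sup>2 + l\<^sup>2) - (k'\<^sup>2 + l'\<^sup>2)"
      using m by (simp add: mod_eq_dvd_iff)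
    also have "(k\<^sup>2 + l\<^sup>2) - (k'\<^sup>2 + l'\<^sup>2) = 2 * ((k - k') * (k - l'))"
      unfolding l by (simp add: power2_eq_square algebra_simps)
    finally have "int q dvd 2 * ((k - k') * (k - l'))" .
    moreover have "coprime (int q) 2"
      using assms(2) by simp
    ultimately have "int q dvd (k - k') * (k - l')"
      using coprime_dvd_mult_right_iff by blast
    then have "int q dvd k - k' \<or> int q dvd k - l'"
      using assms(1) by (simp add: prime_dvd_mult_iff)
    then have "k = k' \<or> k = l'"
      using mem by (auto simp: mod_eq_dvd_iff[symmetric])
    then show ?thesis
      using s by auto
  qed
  have inj: "inj_on f {0..<int q}"
  proof (rule inj_onI)
    fix k l assume "k \<in> {0..<int q}" "l \<in> {0..<int q}" "f k = f l"
    then show "k = l"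
      using sid[of k k l l] by auto
  qed
  have "f ` {0..<int q} \<subseteq> {0..<2 * (int q)\<^sup>2}"
  proof (clarsimp, intro conjI)
    fix k assume k: "0 \<le> k" "k < int q"
    then show "0 \<le> f k"
      using r[of "k\<^sup>2"] by (simp add: f_def)
    have "2 * int q * k \<le> 2 * int q * (int q - 1)"
      using k q by (intro mult_left_mono) auto
    then show "f k < 2 * (int q)\<^sup>2"
      using r[of "k\<^sup>2"] unfolding f_def by (simp add: algebra_simps power2_eq_square)
  qed
  moreover have "sidon (f ` {0..<int q})"
  proof (rule sidonI)
    fix a b c e assume "a \<in> f ` {0..<int q}" "b \<in> f ` {0..<int q}" "c \<in> f ` {0..<int q}" "e \<in> f ` {0..<int q}" "a + b = c + e"
    then obtain k l k' l' where kl: "k \<in> {0..<int q}" "l \<in> {0..<int q}" "k' \<in> {0..<int q}" "l' \<in> {0..<int q}"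
        "a = f k" "b = f l" "c = f k'" "e = f l'"
      by blast
    then have "{k, l} = {k', l'}"
      using sid[of k l k' l'] \<open>a + b = c + e\<close> by blast
    then have "f ` {k, l} = f ` {k', l'}"
      by simp
    then show "{a, b} = {c, e}"
      by (simp add: kl)
  qed
  moreover have "card (f ` {0..<int q}) = q"
    using card_image[OF inj] by simp
  ultimately show ?thesis
    by blast
qed

lemma eventually_dense_sidon_interval:
  fixes \<delta> :: real
  assumes "0 < \<delta>" "\<delta> < 1 / 2"
  shows "\<forall>\<^sub>F M in at_top. \<exists>A \<subseteq> {0..<int M}. sidon A \<and> real M powr (1 / 2 - \<delta>) \<le> real (card A)"
proof -
  define P :: "nat \<Rightarrow> nat" where "P M = nat \<lfloor>sqrt (real M / 2)\<rfloor>" for M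
  have "filterlim P at_top at_top"
    unfolding P_def by real_asymp
  then have "\<forall>\<^sub>F M in at_top. \<exists>q. prime q \<and> q \<le> P M \<and> real (P M) powr (1 - \<delta>) < real q"
    using eventually_prime_ge_powr[OF assms(1)] by (rule eventually_compose_filterlim[rotated])
  moreover have "\<forall>\<^sub>F M :: nat in at_top. real M powr (1 / 2 - \<delta>) \<le> (sqrt (real M / 2) - 1) powr (1 - \<delta>)"
    using assms by real_asymp
  moreover have "\<forall>\<^sub>F M :: nat in at_top. 2 < (sqrt (real M / 2) - 1) powr (1 - \<delta>)"
    using assms by real_asymp
  moreover have "\<forall>\<^sub>F M :: nat in at_top. 0 \<le> sqrt (real M / 2) - 1"
    by real_asymp
  ultimately show ?thesis
  proof eventually_elim
    case (elim M)
    then obtain q where q: "prime q" "q \<le> P M" "real (P M) powr (1 - \<delta>) < real q"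
      by blast
    have "(sqrt (real M / 2) - 1) powr (1 - \<delta>) \<le> real (P M) powr (1 - \<delta>)"
      unfolding P_def
    proof (rule powr_mono2)
      show "sqrt (real M / 2) - 1 \<le> real (nat \<lfloor>sqrt (real M / 2)\<rfloor>)"
        by linarith
    qed (use assms elim in auto)
    then have big: "real M powr (1 / 2 - \<delta>) \<le> real q" "2 < q"
      using elim q(3) by linarith+
    then obtain A :: "int set" where A: "A \<subseteq> {0..<2 * (int q)\<^sup>2}" "sidon A" "card A = q"
      using erdos_turan_sidon[OF q(1)] prime_odd_nat[OF q(1)] by blast
    have "real q \<le> sqrt (real M / 2)"
      using q(2) unfolding P_def by (simp add: le_nat_floor le_nat_iff le_floor_iff)
    then have "(real q)\<^sup>2 \<le> (sqrt (real M / 2))\<^sup>2"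
      by (rule power_mono) simp
    then have "real_of_int (2 * (int q)\<^sup>2) \<le> real_of_int (int M)"
      by simp
    then have "2 * (int q)\<^sup>2 \<le> int M"
      by (simp only: of_int_le_iff)
    then show ?case
      using A big(1) by (intro exI[of _ A]) auto
  qed
qed

section \<open>Blowing up a Sidon set of integers\<close>

lemma sum_digits:
  fixes t m :: int
  assumes "m > 0"
  shows "(\<Sum>i<k. (t div m ^ i) mod m * m ^ i) = t mod m ^ k"
proof (induction k)
  case (Suc k)
  have "t mod (m ^ k * m) = m ^ k * (t div m ^ k mod m) + t mod m ^ k"
    by (rule zmod_zmult2_eq) (use assms in simp)
  then show ?case
    using Suc.IH by (simp add: mult.commute)
qed simp

text \<open>
  The grid is cut into cubes of side \<open>K\<close>, and \<open>block_code\<close> reads the position of the cube of \<open>x\<close> as a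
  number written in base \<open>m\<close>, where \<open>\<rho>\<close> says which coordinate is which digit. A \<open>half_block\<close> is the part
  of a cube in which the coordinates modulo \<open>K\<close> are below \<open>K / 2\<close>: there the addition of two points does
  not carry into the cube positions, so that \<open>block_code\<close> is additive.
\<close>

definition block_code :: "('d \<Rightarrow> nat) \<Rightarrow> int \<Rightarrow> int \<Rightarrow> int ^ 'd \<Rightarrow> int" where
  "block_code \<rho> m K x = (\<Sum>i\<in>UNIV. (x $ i div K) * m ^ \<rho> i)"

definition half_block :: "('d \<Rightarrow> nat) \<Rightarrow> nat \<Rightarrow> nat \<Rightarrow> nat \<Rightarrow> int \<Rightarrow> (int ^ 'd) set" where
  "half_block \<rho> n m K t =
     {x \<in> grid n. block_code \<rho> (int m) (int K) x = t \<and> (\<forall>i. 2 * (x $ i mod int K) < int K)}"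

lemma block_code_add:
  assumes "K > 0" "\<And>i. 2 * (x $ i mod K) < K" "\<And>i. 2 * (y $ i mod K) < K"
  shows "block_code \<rho> m K (x + y) = block_code \<rho> m K x + block_code \<rho> m K y"
proof -
  have "(x $ i + y $ i) div K = x $ i div K + y $ i div K" for i
  proof -
    have "x $ i mod K + y $ i mod K < K"
      using assms(2,3)[of i] by linarith
    then have "(x $ i mod K + y $ i mod K) div K = 0"
      using \<open>K > 0\<close> by (intro div_pos_pos_trivial add_nonneg_nonneg) auto
    then show ?thesis
      by (simp add: div_add1_eq[of "x $ i"])
  qed
  then show ?thesis
    by (simp add: block_code_def sum.distrib distrib_right)
qed

lemma card_half_block_ge:
  fixes \<rho> :: "'d::finite \<Rightarrow> nat"
  assumes "bij_betw \<rho> UNIV {..<CARD('d)}" "K > 0" "m > 0" "m * K \<le> n" "0 \<le> t" "t < int m ^ CARD('d)"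
  shows "finite (half_block \<rho> n m K t)" and "(real K / 2) ^ CARD('d) \<le> real (card (half_block \<rho> n m K t))"
proof -
  define v where "v i = (t div int m ^ \<rho> i) mod int m" for i
  define shift where "shift u = (\<chi> i. int K * v i + u $ i)" for u :: "int ^ 'd"
  let ?h = "(K + 1) div 2"
  show fin: "finite (half_block \<rho> n m K t)"
    by (rule finite_subset[OF _ finite_grid[of n]]) (auto simp: half_block_def)
  have inj: "inj_on shift (grid ?h)"
    by (rule inj_onI) (auto simp: shift_def vec_eq_iff)
  have "shift ` grid ?h \<subseteq> half_block \<rho> n m K t"
  proof (rule image_subsetI)
    fix u :: "int ^ 'd" assume "u \<in> grid ?h"
    then have u: "0 \<le> u $ i" "2 * u $ i < int K" "u $ i < int K" for i
    proof -
      have "0 \<le> u $ i" "u $ i \<le> int ?h - 1"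
        using \<open>u \<in> grid ?h\<close> by (auto simp: grid_def)
      moreover have "2 * int ?h \<le> int K + 1"
        by linarith
      ultimately show "0 \<le> u $ i" "2 * u $ i < int K" "u $ i < int K"
        by linarith+
    qed
    have v: "0 \<le> v i" "v i \<le> int m - 1" for i
      using \<open>m > 0\<close> by (auto simp: v_def)
    have s: "shift u $ i div int K = v i" "shift u $ i mod int K = u $ i" for i
      using u[of i] \<open>K > 0\<close> by (auto simp: shift_def)
    have "0 \<le> shift u $ i \<and> shift u $ i \<le> int n - 1" for i
    proof -
      have "int K * v i \<le> int K * (int m - 1)"
        using v[of i] by (intro mult_left_mono) auto
      moreover have "int m * int K \<le> int n"
        using assms(4) by (metis of_nat_le_iff of_nat_mult)
      moreover have "0 \<le> int K * v i"
        using v[of i] by simp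
      ultimately show ?thesis
        using u[of i] by (simp add: shift_def algebra_simps)
    qed
    moreover have "block_code \<rho> (int m) (int K) (shift u) = t"
    proof -
      have "block_code \<rho> (int m) (int K) (shift u) = (\<Sum>i\<in>UNIV. (t div int m ^ \<rho> i) mod int m * int m ^ \<rho> i)"
        unfolding block_code_def s v_def ..
      also have "\<dots> = (\<Sum>j<CARD('d). (t div int m ^ j) mod int m * int m ^ j)"
        by (rule sum.reindex_bij_betw[OF assms(1)])
      also have "\<dots> = t"
        using sum_digits[of "int m" t] assms by simp
      finally show ?thesis .
    qed
    ultimately show "shift u \<in> half_block \<rho> n m K t"
      using u s by (simp add: half_block_def grid_def)
  qed
  then have "card (shift ` grid ?h) \<le> card (half_block \<rho> n m K t)"
    by (rule card_mono[OF fin])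
  then have "?h ^ CARD('d) \<le> card (half_block \<rho> n m K t)"
    using card_image[OF inj] by (simp add: card_grid)
  then have "real ?h ^ CARD('d) \<le> real (card (half_block \<rho> n m K t))"
    using of_nat_mono[where ?'a = real] by fastforce
  moreover have "(real K / 2) ^ CARD('d) \<le> real ?h ^ CARD('d)"
    by (rule power_mono) linarith+
  ultimately show "(real K / 2) ^ CARD('d) \<le> real (card (half_block \<rho> n m K t))"
    by linarith
qed

text \<open>
  Choose one point of \<open>\<omega>\<close> in each half block. By additivity of the code, a coincidence between sums of
  chosen points is a coincidence between sums of elements of \<open>A\<close>.
\<close>

lemma card_le_max_sidon_of_half_blocks:
  fixes \<rho> :: "'d::finite \<Rightarrow> nat"
  assumes "sidon A" "finite \<omega>" "K > 0" and hit: "\<And>t. t \<in> A \<Longrightarrow> half_block \<rho> n m K t \<inter> \<omega> \<noteq> {}"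
  shows "card A \<le> max_sidon \<omega>"
proof -
  define g where "g t = (SOME x. x \<in> half_block \<rho> n m K t \<inter> \<omega>)" for t
  have g: "g t \<in> half_block \<rho> n m K t \<inter> \<omega>" if "t \<in> A" for t
    unfolding g_def some_in_eq by (rule hit[OF that])
  let ?c = "block_code \<rho> (int m) (int K)"
  have code: "?c (g t) = t" if "t \<in> A" for t
    using g[OF that] by (simp add: half_block_def)
  have code_add: "?c (g s + g t) = s + t" if "s \<in> A" "t \<in> A" for s t
    using block_code_add[of "int K" "g s" "g t" \<rho> "int m"] \<open>K > 0\<close> g[OF that(1)] g[OF that(2)] code that
    by (simp add: half_block_def)
  have "sidon (g ` A)"
  proof (rule sidonI)
    fix x y z w assume "x \<in> g ` A" "y \<in> g ` A" "z \<in> g ` A" "w \<in> g ` A" and eq: "x + y = z + w"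
    then obtain a b c e where abce: "a \<in> A" "b \<in> A" "c \<in> A" "e \<in> A" "x = g a" "y = g b" "z = g c" "w = g e"
      by blast
    have "a + b = c + e"
      using code_add[OF abce(1,2)] code_add[OF abce(3,4)] eq abce(5-8) by simp
    then have "{a, b} = {c, e}"
      using sidonD[OF assms(1)] abce by blast
    then have "g ` {a, b} = g ` {c, e}"
      by simp
    then show "{x, y} = {z, w}"
      by (simp add: abce)
  qed
  moreover have "g ` A \<subseteq> \<omega>"
    using g by blast
  moreover have "card (g ` A) = card A"
    by (rule card_image) (metis code inj_onI)
  ultimately show ?thesis
    using card_le_max_sidon[OF assms(2), of "g ` A"] by simp
qed

lemma prob_max_sidon_less_dense:
  fixes n m K :: nat and q :: real and A :: "int set"
  assumes "0 \<le> q" "q \<le> 1" "K > 0" "m > 0" "m * K \<le> n"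
    and A: "sidon A" "A \<subseteq> {0..<int (m ^ CARD('d))}"
  shows "measure_pmf.prob (random_grid n q) {\<omega> :: (int ^ 'd) set. max_sidon \<omega> < card A}
    \<le> real n ^ CARD('d) * exp (- q * (real K / 2) ^ CARD('d))"
proof -
  obtain \<rho> :: "'d \<Rightarrow> nat" where \<rho>: "bij_betw \<rho> UNIV {..<CARD('d)}"
    using ex_bij_betw_finite_nat[OF finite, of "UNIV :: 'd set"] by (auto simp: atLeast0LessThan)
  have finA: "finite A"
    using A(2) finite_subset by blast
  have "m * 1 \<le> m * K"
    using assms(3) by (intro mult_left_mono) auto
  then have "m \<le> n"
    using assms(5) by linarith
  have "card A \<le> card {0..<int (m ^ CARD('d))}"
    by (rule card_mono) (use A in auto)
  also have "\<dots> \<le> n ^ CARD('d)"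
    using power_mono[OF \<open>m \<le> n\<close>, of "CARD('d)"] by (simp del: of_nat_power)
  finally have cardA: "real (card A) \<le> real n ^ CARD('d)"
    by (metis of_nat_le_iff of_nat_power)
  have "measure_pmf.prob (random_grid n q) {\<omega> :: (int ^ 'd) set. max_sidon \<omega> < card A}
      \<le> real (card A) * exp (- q * (real K / 2) ^ CARD('d))"
  proof (rule prob_union_bound[OF finA])
    fix \<omega> :: "(int ^ 'd) set"
    assume \<omega>: "\<omega> \<in> set_pmf (random_grid n q)" "\<omega> \<in> {\<omega>. max_sidon \<omega> < card A}"
    then have "finite \<omega>"
      using set_pmf_random_grid[OF \<omega>(1)] finite_subset[OF _ finite_grid] by auto
    then have "\<exists>t\<in>A. half_block \<rho> n m K t \<inter> \<omega> = {}"
      using card_le_max_sidon_of_half_blocks[OF A(1) _ assms(3), of \<omega> \<rho> n m] \<omega>(2) by fastforce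
    then show "\<exists>t\<in>A. \<omega> \<in> {\<omega>. half_block \<rho> n m K t \<inter> \<omega> = {}}"
      by simp
  next
    fix t assume "t \<in> A"
    then have t: "0 \<le> t" "t < int m ^ CARD('d)"
      using A(2) by auto
    have "q * (real K / 2) ^ CARD('d) \<le> q * real (card (half_block \<rho> n m K t))"
      using card_half_block_ge(2)[OF \<rho> assms(3-5) t] assms(1) by (rule mult_left_mono)
    then show "measure_pmf.prob (random_grid n q) {\<omega>. half_block \<rho> n m K t \<inter> \<omega> = {}}
        \<le> exp (- q * (real K / 2) ^ CARD('d))"
      by (intro order_trans[OF prob_random_grid_avoids[OF _ assms(1,2)]])
        (simp_all add: half_block_def subset_eq)
  qed
  also have "\<dots> \<le> real n ^ CARD('d) * exp (- q * (real K / 2) ^ CARD('d))"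
    using cardA by (rule mult_right_mono) simp
  finally show ?thesis .
qed

section \<open>The four asymptotic bounds\<close>

lemma prob_tendsto_zeroI:
  assumes "\<forall>\<^sub>F n in at_top. measure_pmf.prob (M n) (E n) \<le> f n" and "f \<longlonglongrightarrow> (0 :: real)"
  shows "(\<lambda>n. measure_pmf.prob (M n) (E n)) \<longlonglongrightarrow> 0"
  by (rule tendsto_sandwich[OF _ assms(1) tendsto_const assms(2)]) simp

text \<open>
  The interval around \<open>n powr b\<close> grows with \<open>\<eta>\<close>, so the lower bound is only needed for small \<open>\<eta>\<close>.
\<close>

lemma aas_power_if_bad_events_vanish:
  fixes M :: "nat \<Rightarrow> 'b pmf" and X :: "'b \<Rightarrow> nat"
  assumes "b > 0"
    and upper: "\<And>\<eta>. 0 < \<eta> \<Longrightarrow> (\<lambda>n. measure_pmf.prob (M n) {\<omega>. real n powr (b + \<eta>) < real (X \<omega>)}) \<longlonglongrightarrow> 0"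
    and lower: "\<And>\<eta>. 0 < \<eta> \<Longrightarrow> \<eta> < b \<Longrightarrow> (\<lambda>n. measure_pmf.prob (M n) {\<omega>. real (X \<omega>) < real n powr (b - \<eta>)}) \<longlonglongrightarrow> 0"
  shows "aas_power M X b"
  unfolding aas_power_def
proof (intro allI impI)
  fix \<eta> :: real assume "\<eta> > 0"
  define \<theta> where "\<theta> = min \<eta> (b / 2)"
  have \<theta>: "0 < \<theta>" "\<theta> < b" "\<theta> \<le> \<eta>"
    using \<open>\<eta> > 0\<close> \<open>b > 0\<close> by (auto simp: \<theta>_def)
  let ?G = "\<lambda>n. {\<omega>. real n powr (b - \<eta>) \<le> real (X \<omega>) \<and> real (X \<omega>) \<le> real n powr (b + \<eta>)}"
  let ?L = "\<lambda>n. {\<omega>. real (X \<omega>) < real n powr (b - \<theta>)}"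
  let ?U = "\<lambda>n. {\<omega>. real n powr (b + \<eta>) < real (X \<omega>)}"
  have "(\<lambda>n. 1 - (measure_pmf.prob (M n) (?L n) + measure_pmf.prob (M n) (?U n))) \<longlonglongrightarrow> 1 - (0 + 0)"
    by (intro tendsto_diff tendsto_add tendsto_const lower upper \<theta> \<open>\<eta> > 0\<close>)
  then have lim: "(\<lambda>n. 1 - (measure_pmf.prob (M n) (?L n) + measure_pmf.prob (M n) (?U n))) \<longlonglongrightarrow> 1"
    by simp
  have "\<forall>\<^sub>F n :: nat in at_top. n \<ge> 1"
    by (rule eventually_ge_at_top)
  then have "\<forall>\<^sub>F n in at_top. 1 - (measure_pmf.prob (M n) (?L n) + measure_pmf.prob (M n) (?U n)) \<le> measure_pmf.prob (M n) (?G n)"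
  proof eventually_elim
    case (elim n)
    have "real n powr (b - \<eta>) \<le> real n powr (b - \<theta>)"
      using elim \<theta> by (intro powr_mono) auto
    then have "UNIV - ?G n \<subseteq> ?L n \<union> ?U n"
      by auto
    then have "measure_pmf.prob (M n) (UNIV - ?G n) \<le> measure_pmf.prob (M n) (?L n \<union> ?U n)"
      by (rule measure_pmf.finite_measure_mono) simp
    also have "\<dots> \<le> measure_pmf.prob (M n) (?L n) + measure_pmf.prob (M n) (?U n)"
      by (rule measure_Un_le) simp_all
    finally show ?case
      using measure_pmf.prob_compl[of "?G n" "M n"] by simp
  qed
  then show "(\<lambda>n. measure_pmf.prob (M n) (?G n)) \<longlonglongrightarrow> 1"
    by (rule tendsto_sandwich[OF _ _ lim tendsto_const]) (simp add: measure_pmf.prob_le_1)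
qed

context
  fixes a :: real and p :: "nat \<Rightarrow> real"
  assumes p_range: "\<And>n. n > 0 \<Longrightarrow> 0 \<le> p n \<and> p n \<le> 1"
    and p_asymp: "p \<sim>[at_top] (\<lambda>n. real n powr a)"
begin

lemma eventually_p_bounds:
  "\<forall>\<^sub>F n in at_top. n > 0 \<and> 0 \<le> p n \<and> p n \<le> 1 \<and> real n powr a / 2 \<le> p n \<and> p n \<le> 2 * real n powr a"
proof -
  have pos: "\<forall>\<^sub>F n :: nat in at_top. n > 0"
    by (rule eventually_gt_at_top)
  then have "\<forall>\<^sub>F n :: nat in at_top. p n \<noteq> 0 \<or> real n powr a \<noteq> 0"
    by eventually_elim simp
  then have lim: "((\<lambda>n. p n / real n powr a) \<longlongrightarrow> 1) at_top"
    by (rule asymp_equivD_strong[OF p_asymp])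
  have "\<forall>\<^sub>F n in at_top. 1 / 2 < p n / real n powr a" "\<forall>\<^sub>F n in at_top. p n / real n powr a < 2"
    by (rule order_tendstoD[OF lim]; simp)+
  with pos show ?thesis
    by eventually_elim (use p_range in \<open>auto simp: field_simps\<close>)
qed

text \<open>
  The random set itself has about \<open>n powr (a + d)\<close> points.
\<close>

lemma max_sidon_upper_trivial:
  fixes \<eta> d :: real
  defines "d \<equiv> real CARD('d::finite)"
  assumes "\<eta> > 0"
  shows "(\<lambda>n. measure_pmf.prob (random_grid n (p n))
           {\<omega> :: (int ^ 'd) set. real n powr (a + d + \<eta>) < real (max_sidon \<omega>)}) \<longlonglongrightarrow> 0"
proof (rule prob_tendsto_zeroI)
  have "\<forall>\<^sub>F n :: nat in at_top. 2 * exp 1 * real n powr - \<eta> < 1"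
    using assms by real_asymp
  with eventually_p_bounds
  show "\<forall>\<^sub>F n in at_top. measure_pmf.prob (random_grid n (p n))
           {\<omega> :: (int ^ 'd) set. real n powr (a + d + \<eta>) < real (max_sidon \<omega>)} \<le> 2 * exp 1 * real n powr - \<eta>"
  proof eventually_elim
    case (elim n)
    define m where "m = nat \<lceil>real n powr (a + d + \<eta>)\<rceil>"
    have M: "real n powr (a + d + \<eta>) > 0"
      using elim by simp
    then have m: "m > 0" "real n powr (a + d + \<eta>) \<le> real m"
      unfolding m_def by linarith+
    have N: "real n ^ CARD('d) = real n powr d"
      using elim by (simp add: d_def powr_realpow)
    let ?B = "exp 1 * real (card (grid n :: (int ^ 'd) set)) * p n / real m"
    have "?B \<le> exp 1 * real n powr d * (2 * real n powr a) / real n powr (a + d + \<eta>)"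
      unfolding card_grid of_nat_power N using elim M m
      by (intro frac_le mult_left_mono mult_nonneg_nonneg) auto
    also have "\<dots> = 2 * exp 1 * real n powr - \<eta>"
      using elim by (simp add: powr_add powr_minus field_simps)
    finally have B: "?B \<le> 2 * exp 1 * real n powr - \<eta>" .
    have "measure_pmf.prob (random_grid n (p n)) {\<omega> :: (int ^ 'd) set. real n powr (a + d + \<eta>) < real (max_sidon \<omega>)}
        = measure_pmf.prob (random_grid n (p n))
            ({\<omega> :: (int ^ 'd) set. real n powr (a + d + \<eta>) < real (max_sidon \<omega>)} \<inter> set_pmf (random_grid n (p n)))"
      by (simp add: measure_Int_set_pmf)
    also have "\<dots> \<le> measure_pmf.prob (random_grid n (p n)) {\<omega>. \<exists>S. S \<subseteq> \<omega> \<inter> (grid n :: (int ^ 'd) set) \<and> card S = m}"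
    proof (rule measure_pmf.finite_measure_mono, safe)
      fix \<omega> :: "(int ^ 'd) set"
      assume \<omega>: "\<omega> \<in> set_pmf (random_grid n (p n))" "real n powr (a + d + \<eta>) < real (max_sidon \<omega>)"
      have sub: "\<omega> \<subseteq> grid n" "finite \<omega>"
        using set_pmf_random_grid[OF \<omega>(1)] finite_subset[OF _ finite_grid] by auto
      have "m \<le> max_sidon \<omega>"
        using \<omega>(2) unfolding m_def by linarith
      then have "m \<le> card \<omega>"
        using max_sidon_le_card[OF sub(2)] by linarith
      then obtain S where "S \<subseteq> \<omega>" "card S = m"
        using obtain_subset_with_card_n by blast
      then show "\<exists>S. S \<subseteq> \<omega> \<inter> grid n \<and> card S = m"
        using sub(1) by auto
    qed simp
    also have "\<dots> \<le> ?B ^ m"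
      using elim m(1) by (intro prob_random_grid_large_intersection finite_grid) auto
    also have "\<dots> \<le> ?B ^ 1"
    proof (rule power_decreasing)
      show "?B \<le> 1"
        using B elim by linarith
      show "0 \<le> ?B"
        using elim by simp
    qed (use m(1) in simp)
    also have "\<dots> \<le> 2 * exp 1 * real n powr - \<eta>"
      using B by simp
    finally show ?case .
  qed
  show "(\<lambda>n. 2 * exp 1 * real n powr - \<eta>) \<longlonglongrightarrow> 0"
    using assms by real_asymp
qed

text \<open>
  Let \<open>M = n powr (b + \<eta>)\<close> and apply \<open>prob_max_sidon_ge\<close> with \<open>m\<close> about \<open>M\<close>, with
  \<open>s\<close> about \<open>\<sigma> = M * n powr (- \<eta> / 2)\<close> and with the least admissible \<open>j\<close>. The number of containers
  is at most \<open>exp (M / 2)\<close> because \<open>s + j\<close> is smaller than \<open>M\<close> by a power of \<open>n\<close>; for \<open>j\<close>, which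
  is about \<open>n powr d / s\<^sup>2\<close>, this is the inequality \<open>d \<le> 3 * b\<close>. The expected number of random points
  in a container is smaller than \<open>M\<close> by a power of \<open>n\<close> because of \<open>a + d \<le> 2 * b\<close>, so that the
  second factor is at most \<open>exp (- M)\<close>. The function \<open>h\<close> bounds \<open>(s + j) / M\<close>.
\<close>

lemma max_sidon_upper_containers:
  fixes b \<eta> d :: real
  defines "d \<equiv> real CARD('d::finite)"
  assumes "\<eta> > 0" and b: "d \<le> 3 * b" "a + d \<le> 2 * b"
  shows "(\<lambda>n. measure_pmf.prob (random_grid n (p n))
           {\<omega> :: (int ^ 'd) set. real n powr (b + \<eta>) < real (max_sidon \<omega>)}) \<longlonglongrightarrow> 0"
proof (rule prob_tendsto_zeroI)
  define c where "c = b + \<eta> / 2"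
  define g where "g = (2 :: real) ^ CARD('d)"
  define h where "h x = x powr - (\<eta> / 2) + 2 * x powr - (b + \<eta>) + 2 * g * ln (x powr c + 1) * x powr (- 2 * \<eta>)" for x
  have "d > 0" "g > 0"
    by (auto simp: d_def g_def)
  then have "b > 0" "c > 0"
    using b(1) \<open>\<eta> > 0\<close> by (auto simp: c_def)
  have "((\<lambda>n. h (real n) * ln (real n powr d + 1)) \<longlongrightarrow> 0) at_top"
  proof -
    have "(\<lambda>n. real n powr - (\<eta> / 2) * ln (real n powr d + 1)) \<longlonglongrightarrow> 0"
      using \<open>\<eta> > 0\<close> \<open>d > 0\<close> by real_asymp
    moreover have "(\<lambda>n. 2 * real n powr - (b + \<eta>) * ln (real n powr d + 1)) \<longlonglongrightarrow> 0"
      using \<open>\<eta> > 0\<close> \<open>b > 0\<close> \<open>d > 0\<close> by real_asymp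
    moreover have "(\<lambda>n. 2 * g * (ln (real n powr c + 1) * real n powr (- 2 * \<eta>) * ln (real n powr d + 1))) \<longlonglongrightarrow> 2 * g * 0"
    proof (rule tendsto_mult_left)
      show "(\<lambda>n. ln (real n powr c + 1) * real n powr (- 2 * \<eta>) * ln (real n powr d + 1)) \<longlonglongrightarrow> 0"
        using \<open>\<eta> > 0\<close> \<open>c > 0\<close> \<open>d > 0\<close> by real_asymp
    qed
    ultimately have "(\<lambda>n. real n powr - (\<eta> / 2) * ln (real n powr d + 1) + 2 * real n powr - (b + \<eta>) * ln (real n powr d + 1)
        + 2 * g * (ln (real n powr c + 1) * real n powr (- 2 * \<eta>) * ln (real n powr d + 1))) \<longlonglongrightarrow> 0 + 0 + 2 * g * 0"
      by (intro tendsto_add)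
    then show ?thesis
      by (simp add: h_def algebra_simps)
  qed
  then have E1: "\<forall>\<^sub>F n in at_top. h (real n) * ln (real n powr d + 1) < 1 / 2"
    by (rule order_tendstoD) simp
  have "((\<lambda>n. exp 1 * (4 * g * real n powr (- (3 / 2) * \<eta>) + h (real n))) \<longlongrightarrow> exp 1 * (4 * g * 0 + (0 + 0 + 2 * g * 0))) at_top"
  proof (intro tendsto_mult_left tendsto_add)
    show "(\<lambda>n. real n powr (- (3 / 2) * \<eta>)) \<longlonglongrightarrow> 0"
      using \<open>\<eta> > 0\<close> by real_asymp
    have "(\<lambda>n. real n powr - (\<eta> / 2)) \<longlonglongrightarrow> 0"
      using \<open>\<eta> > 0\<close> by real_asymp
    moreover have "(\<lambda>n. 2 * real n powr - (b + \<eta>)) \<longlonglongrightarrow> 0"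
      using \<open>\<eta> > 0\<close> \<open>b > 0\<close> by real_asymp
    moreover have "(\<lambda>n. 2 * g * (ln (real n powr c + 1) * real n powr (- 2 * \<eta>))) \<longlonglongrightarrow> 2 * g * 0"
    proof (rule tendsto_mult_left)
      show "(\<lambda>n. ln (real n powr c + 1) * real n powr (- 2 * \<eta>)) \<longlonglongrightarrow> 0"
        using \<open>\<eta> > 0\<close> \<open>c > 0\<close> by real_asymp
    qed
    ultimately have "(\<lambda>n. real n powr - (\<eta> / 2) + 2 * real n powr - (b + \<eta>)
        + 2 * g * (ln (real n powr c + 1) * real n powr (- 2 * \<eta>))) \<longlonglongrightarrow> 0 + 0 + 2 * g * 0"
      by (intro tendsto_add)
    then show "(\<lambda>n. h (real n)) \<longlonglongrightarrow> 0 + 0 + 2 * g * 0"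
      by (simp add: h_def mult.assoc)
  qed
  then have E2: "\<forall>\<^sub>F n in at_top. exp 1 * (4 * g * real n powr (- (3 / 2) * \<eta>) + h (real n)) < exp (- 1)"
    by (rule order_tendstoD) simp
  show "(\<lambda>n. exp (- (real n powr (b + \<eta>) / 2))) \<longlonglongrightarrow> 0"
    using \<open>\<eta> > 0\<close> \<open>b > 0\<close> by real_asymp
  show "\<forall>\<^sub>F n in at_top. measure_pmf.prob (random_grid n (p n))
           {\<omega> :: (int ^ 'd) set. real n powr (b + \<eta>) < real (max_sidon \<omega>)} \<le> exp (- (real n powr (b + \<eta>) / 2))"
    using eventually_p_bounds E1 E2
  proof eventually_elim
    case (elim n)
    define x where "x = real n"
    have x: "x \<ge> 1"
      using elim by (auto simp: x_def)
    define M where "M = x powr (b + \<eta>)"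
    define \<sigma> where "\<sigma> = x powr c"
    define m where "m = nat \<lceil>M\<rceil>"
    define s where "s = nat \<lceil>\<sigma>\<rceil>"
    define G where "G = real ((2 * n) ^ CARD('d))"
    define j where "j = nat \<lceil>2 * G * ln (real s) / (real s)\<^sup>2\<rceil>"
    have N: "real n ^ CARD('d) = x powr d"
      using elim by (simp add: x_def d_def powr_realpow)
    have G: "G = g * x powr d" "G > 0"
      using x by (auto simp: G_def g_def N power_mult_distrib)
    have pos: "M > 0" "\<sigma> > 0"
      using x by (auto simp: M_def \<sigma>_def)
    have \<sigma>M: "\<sigma> = M * x powr - (\<eta> / 2)" "\<sigma> \<le> M"
      using x \<open>\<eta> > 0\<close> by (auto simp: \<sigma>_def M_def c_def powr_add[symmetric] add.commute intro!: powr_mono)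
    have m: "M \<le> real m"
      unfolding m_def by linarith
    have s: "s > 0" "\<sigma> \<le> real s" "real s \<le> \<sigma> + 1" "s \<le> m"
      using pos \<sigma>M(2) unfolding s_def m_def by (linarith, linarith, linarith, intro nat_mono ceiling_mono)
    have ln_s: "0 \<le> ln (real s)" "ln (real s) \<le> ln (\<sigma> + 1)"
      using s by auto
    have "ln (real s) = (real s)\<^sup>2 / (2 * G) * (2 * G * ln (real s) / (real s)\<^sup>2)"
      using s(1) G(2) by simp
    also have "\<dots> \<le> (real s)\<^sup>2 / (2 * G) * real j"
      using G(2) unfolding j_def by (intro mult_left_mono) (linarith, simp)
    finally have "exp (ln (real s)) \<le> exp ((real s)\<^sup>2 / (2 * G) * real j)"
      by simp
    then have enough: "real s \<le> exp ((real s)\<^sup>2 / (2 * G) * real j)"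
      using s(1) by simp
    \<comment> \<open>The three terms of \<open>h\<close> pay for \<open>\<sigma>\<close>, for rounding \<open>s\<close> and \<open>j\<close> up, and for \<open>j\<close> itself.\<close>
    have sj: "real s + real j \<le> M * h x"
    proof -
      have le: "2 * G * ln (real s) / (real s)\<^sup>2 \<le> 2 * G * ln (\<sigma> + 1) / \<sigma>\<^sup>2"
        using ln_s s(2) pos G(2) by (intro frac_le mult_left_mono mult_nonneg_nonneg power_mono) auto
      have "real j \<le> 2 * G * ln (\<sigma> + 1) / \<sigma>\<^sup>2 + 1"
      proof -
        have "0 \<le> 2 * G * ln (real s) / (real s)\<^sup>2"
          using G(2) ln_s(1) by simp
        moreover have "real (nat \<lceil>y\<rceil>) \<le> y + 1" if "0 \<le> y" for y :: real
          using that by linarith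
        ultimately have "real j \<le> 2 * G * ln (real s) / (real s)\<^sup>2 + 1"
          unfolding j_def by blast
        with le show ?thesis
          by linarith
      qed
      moreover have "2 * G * ln (\<sigma> + 1) / \<sigma>\<^sup>2 = 2 * g * ln (\<sigma> + 1) * x powr (d - 2 * c)"
        using x by (simp add: G(1) \<sigma>_def powr_diff powr_mult_base power2_eq_square flip: powr_add)
      moreover have "2 * g * ln (\<sigma> + 1) * x powr (d - 2 * c) \<le> 2 * g * ln (\<sigma> + 1) * x powr (b + \<eta> - 2 * \<eta>)"
        using x b(1) pos \<open>g > 0\<close> by (intro mult_left_mono powr_mono) (auto simp: c_def)
      ultimately have "real s + real j \<le> \<sigma> + 2 + 2 * g * ln (\<sigma> + 1) * x powr (b + \<eta> - 2 * \<eta>)"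
        using s(3) by linarith
      also have "\<dots> = M * h x"
      proof -
        have "M * x powr - (b + \<eta>) = 1" "M * x powr (- 2 * \<eta>) = x powr (b + \<eta> - 2 * \<eta>)"
          using x by (auto simp: M_def powr_add[symmetric])
        moreover have "M * h x = M * x powr - (\<eta> / 2) + 2 * (M * x powr - (b + \<eta>))
            + 2 * g * ln (\<sigma> + 1) * (M * x powr (- 2 * \<eta>))"
          unfolding h_def \<sigma>_def[symmetric] by (simp only: distrib_left mult_ac)
        ultimately show ?thesis
          unfolding \<sigma>M(1)[symmetric] by simp
      qed
      finally show ?thesis .
    qed
    have Gs: "2 * G / real s * p n \<le> M * (4 * g * x powr (- (3 / 2) * \<eta>))"
    proof -
      have "2 * G / real s * p n \<le> 2 * G / \<sigma> * (2 * x powr a)"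
        using s(1,2) pos G(2) elim by (intro mult_mono frac_le) (auto simp: x_def)
      also have "\<dots> = 4 * g * x powr (d + a - c)"
        using x by (simp add: G(1) \<sigma>_def powr_diff powr_add)
      also have "\<dots> \<le> 4 * g * x powr (b + \<eta> + - (3 / 2) * \<eta>)"
        using x b(2) \<open>g > 0\<close> by (intro mult_left_mono powr_mono) (auto simp: c_def)
      also have "\<dots> = M * (4 * g * x powr (- (3 / 2) * \<eta>))"
        unfolding M_def powr_add by simp
      finally show ?thesis .
    qed
    let ?Q = "exp 1 * (2 * G / real s + real j + real s) * p n / real m"
    have "(2 * G / real s + real j + real s) * p n \<le> 2 * G / real s * p n + (real s + real j) * 1"
      using elim mult_left_mono[of "p n" 1 "real s + real j"] by (simp add: algebra_simps)
    also have "\<dots> \<le> M * (4 * g * x powr (- (3 / 2) * \<eta>) + h x)"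
      using sj Gs by (simp add: distrib_left)
    finally have "(2 * G / real s + real j + real s) * p n \<le> M * (4 * g * x powr (- (3 / 2) * \<eta>) + h x)" .
    then have "exp 1 * ((2 * G / real s + real j + real s) * p n) \<le> exp 1 * (M * (4 * g * x powr (- (3 / 2) * \<eta>) + h x))"
      by (rule mult_left_mono) simp
    also have "\<dots> = M * (exp 1 * (4 * g * x powr (- (3 / 2) * \<eta>) + h x))"
      by (rule mult.left_commute)
    also have "\<dots> \<le> M * exp (- 1)"
      using elim pos unfolding x_def by (intro mult_left_mono less_imp_le) blast+
    also have "\<dots> \<le> real m * exp (- 1)"
      using m by simp
    finally have Q: "?Q \<le> exp (- 1)"
      using pos m by (simp add: pos_divide_le_eq mult_ac)
    have Q0: "0 \<le> ?Q"
      using elim G(2) by simp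
    have "real (s + j) * ln (x powr d + 1) \<le> M * h x * ln (x powr d + 1)"
      using sj by (intro mult_right_mono) auto
    also have "\<dots> = M * (h x * ln (x powr d + 1))"
      by simp
    also have "\<dots> \<le> M * (1 / 2)"
      using elim pos by (intro mult_left_mono) (auto simp: x_def)
    finally have fingerprints: "real (s + j) * ln (x powr d + 1) \<le> M / 2"
      by simp
    have "(x powr d + 1) ^ (s + j) = exp (real (s + j) * ln (x powr d + 1))"
      unfolding exp_of_nat_mult by (subst exp_ln) (simp_all add: add_pos_nonneg add.commute)
    then have count: "(x powr d + 1) ^ (s + j) \<le> exp (M / 2)"
      using fingerprints by simp
    have "measure_pmf.prob (random_grid n (p n)) {\<omega> :: (int ^ 'd) set. real n powr (b + \<eta>) < real (max_sidon \<omega>)}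
        \<le> measure_pmf.prob (random_grid n (p n)) {\<omega> :: (int ^ 'd) set. m \<le> max_sidon \<omega>}"
    proof (rule measure_pmf.finite_measure_mono)
      have "m \<le> k" if "M < real k" for k
        using that unfolding m_def by linarith
      then show "{\<omega> :: (int ^ 'd) set. real n powr (b + \<eta>) < real (max_sidon \<omega>)} \<subseteq> {\<omega>. m \<le> max_sidon \<omega>}"
        by (auto simp: M_def x_def)
    qed simp
    also have "\<dots> \<le> (real n ^ CARD('d) + 1) ^ (s + j) * ?Q ^ m"
      unfolding G_def using elim s enough[unfolded G_def] by (intro prob_max_sidon_ge) auto
    also have "\<dots> \<le> exp (M / 2) * exp (- 1) ^ m"
      unfolding N using count Q Q0 by (intro mult_mono power_mono) auto
    also have "\<dots> = exp (M / 2 - real m)"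
      by (simp add: exp_of_nat_mult[symmetric] exp_add[symmetric])
    also have "\<dots> \<le> exp (- (M / 2))"
      using m by simp
    finally show ?case
      by (simp add: M_def x_def)
  qed
qed

text \<open>
  In \<open>prob_max_sidon_less\<close> take \<open>k\<close> about \<open>n powr (\<mu> - \<eta>)\<close>. The inequality \<open>3 * \<mu> \<le> d\<close> keeps the number
  of forbidden points below half of the grid, and \<open>\<mu> \<le> a + d\<close> makes \<open>exp (- p n * n ^ d / 2)\<close> beat the
  number of candidate sets.
\<close>

lemma max_sidon_lower_maximal:
  fixes \<eta> d \<mu> :: real
  defines "d \<equiv> real CARD('d::finite)"
  assumes "0 < \<eta>" "\<eta> < \<mu>" "\<mu> \<le> a + d" "3 * \<mu> \<le> d"
  shows "(\<lambda>n. measure_pmf.prob (random_grid n (p n))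
           {\<omega> :: (int ^ 'd) set. real (max_sidon \<omega>) < real n powr (\<mu> - \<eta>)}) \<longlonglongrightarrow> 0"
proof (rule prob_tendsto_zeroI)
  have "d > 0"
    by (simp add: d_def)
  have pos: "a + d > 0" "\<mu> > 0"
    using assms by auto
  show "(\<lambda>n. exp (- (real n powr (a + d) / 8))) \<longlonglongrightarrow> 0"
    using pos by real_asymp
  have "\<forall>\<^sub>F n :: nat in at_top. 48 * real n powr (- 3 * \<eta>) < 1"
    using assms(2) by real_asymp
  moreover have "\<forall>\<^sub>F n :: nat in at_top. real n powr - \<eta> * ln (real n powr d + 1) < 1 / 16"
    using assms(2) \<open>d > 0\<close> by real_asymp
  ultimately show "\<forall>\<^sub>F n in at_top. measure_pmf.prob (random_grid n (p n))
           {\<omega> :: (int ^ 'd) set. real (max_sidon \<omega>) < real n powr (\<mu> - \<eta>)} \<le> exp (- (real n powr (a + d) / 8))"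
    using eventually_p_bounds
  proof eventually_elim
    case (elim n)
    define x where "x = real n"
    have x: "x \<ge> 1"
      using elim by (auto simp: x_def)
    define M where "M = x powr (\<mu> - \<eta>)"
    define k where "k = nat \<lceil>M\<rceil>"
    have N: "real n ^ CARD('d) = x powr d"
      using elim by (simp add: x_def d_def powr_realpow)
    have "M \<ge> 1"
      using x assms unfolding M_def by (intro ge_one_powr_ge_zero) auto
    then have k: "M \<le> real k" "real k \<le> 2 * M" "k \<ge> 1"
      unfolding k_def by linarith+
    have "2 * (k ^ 3 + k ^ 2 + k) \<le> 6 * k ^ 3"
      using power_increasing[of 1 3 k] power_increasing[of 2 3 k] k(3) by simp
    then have "real (2 * (k ^ 3 + k ^ 2 + k)) \<le> real (6 * k ^ 3)"
      by (rule of_nat_mono)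
    also have "\<dots> \<le> 6 * (2 * M) ^ 3"
      using power_mono[OF k(2), of 3] by simp
    also have "\<dots> = 48 * x powr (3 * (\<mu> - \<eta>))"
      using x by (simp add: M_def power_mult_distrib powr_power mult.commute)
    also have "\<dots> \<le> 48 * x powr (d - 3 * \<eta>)"
      using x assms by (intro mult_left_mono powr_mono) auto
    also have "\<dots> = 48 * x powr (- 3 * \<eta>) * x powr d"
      using x by (simp add: powr_add[symmetric])
    also have "\<dots> \<le> 1 * x powr d"
      using elim by (intro mult_right_mono) (auto simp: x_def)
    finally have "real (2 * (k ^ 3 + k ^ 2 + k)) \<le> real (n ^ CARD('d))"
      using N by simp
    then have small: "2 * (k ^ 3 + k ^ 2 + k) \<le> n ^ CARD('d)"
      by (simp only: of_nat_le_iff)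
    have "M \<le> x powr (a + d + - \<eta>)"
      unfolding M_def using x assms by (intro powr_mono) auto
    then have M: "M \<le> x powr (a + d) * x powr - \<eta>"
      by (simp only: powr_add)
    have "real k * ln (x powr d + 1) \<le> 2 * (x powr (a + d) * x powr - \<eta>) * ln (x powr d + 1)"
      using k M by (intro mult_right_mono) auto
    also have "\<dots> = 2 * x powr (a + d) * (x powr - \<eta> * ln (x powr d + 1))"
      by simp
    also have "\<dots> \<le> 2 * x powr (a + d) * (1 / 16)"
      using elim by (intro mult_left_mono) (auto simp: x_def)
    finally have le: "real k * ln (x powr d + 1) \<le> x powr (a + d) / 8"
      by simp
    have "(x powr d + 1) ^ k = exp (real k * ln (x powr d + 1))"
      unfolding exp_of_nat_mult by (subst exp_ln) (simp_all add: add_pos_nonneg add.commute)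
    then have count: "(x powr d + 1) ^ k \<le> exp (x powr (a + d) / 8)"
      using le by simp
    have "x powr a / 2 * (x powr d / 2) \<le> p n * (x powr d / 2)"
      using elim by (intro mult_right_mono) (auto simp: x_def)
    then have pN: "x powr (a + d) / 4 \<le> p n * (x powr d / 2)"
      by (simp add: powr_add)
    have "measure_pmf.prob (random_grid n (p n)) {\<omega> :: (int ^ 'd) set. real (max_sidon \<omega>) < real n powr (\<mu> - \<eta>)}
        \<le> measure_pmf.prob (random_grid n (p n)) {\<omega> :: (int ^ 'd) set. max_sidon \<omega> < k}"
      by (rule measure_pmf.finite_measure_mono) (use k(1) in \<open>auto simp: M_def x_def\<close>)
    also have "\<dots> \<le> (real n ^ CARD('d) + 1) ^ k * exp (- p n * (real n ^ CARD('d) / 2))"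
      using elim small by (intro prob_max_sidon_less) auto
    also have "\<dots> \<le> exp (x powr (a + d) / 8) * exp (- (x powr (a + d) / 4))"
      unfolding N using count pN by (intro mult_mono) auto
    also have "\<dots> = exp (- (x powr (a + d) / 8))"
      by (simp add: exp_add[symmetric])
    finally show ?case
      by (simp add: x_def)
  qed
qed

text \<open>
  The side \<open>K = n powr \<kappa>\<close> of the cubes is such that a half block contains about \<open>n powr \<eta>\<close> random
  points on average, which is enough for all half blocks to contain one simultaneously. The
  number of cubes is then about \<open>n powr (a + d - \<eta>)\<close>, and a Sidon set in the codes has nearly the square
  root of this size. The loss \<open>\<delta>\<close> in the exponent \<open>1 / 2\<close> is chosen such that it costs at most a factor
  \<open>n powr (\<eta> / 4)\<close>.
\<close>

lemma max_sidon_lower_blowup: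
  fixes \<eta> d :: real
  defines "d \<equiv> real CARD('d::finite)"
  assumes "a \<le> 0" "0 < \<eta>" "\<eta> < (a + d) / 2"
  shows "(\<lambda>n. measure_pmf.prob (random_grid n (p n))
           {\<omega> :: (int ^ 'd) set. real (max_sidon \<omega>) < real n powr ((a + d) / 2 - \<eta>)}) \<longlonglongrightarrow> 0"
proof (rule prob_tendsto_zeroI)
  have "d > 0"
    by (simp add: d_def)
  have "a + d > 0"
    using assms by auto
  define \<kappa> where "\<kappa> = (\<eta> - a) / d"
  define \<delta> where "\<delta> = \<eta> / (4 * (a + d))"
  define g where "g = (4 :: real) ^ CARD('d)"
  have \<kappa>: "0 < \<kappa>" "\<kappa> < 1" "\<kappa> * d = \<eta> - a"
    using assms \<open>d > 0\<close> by (auto simp: \<kappa>_def field_simps)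
  have \<delta>: "0 < \<delta>" "\<delta> < 1 / 2" "\<delta> * (a + d) = \<eta> / 4"
    using assms \<open>a + d > 0\<close> by (auto simp: \<delta>_def field_simps)
  have "g > 0"
    by (simp add: g_def)
  define K where "K n = nat \<lceil>real n powr \<kappa>\<rceil>" for n :: nat
  define m where "m n = n div K n" for n
  have big_m: "\<forall>\<^sub>F n in at_top. real n powr (1 - \<kappa>) / 4 \<le> real (m n) \<and> real n powr \<kappa> \<le> real (K n) \<and> 1 \<le> real n powr \<kappa>"
  proof -
    have "\<forall>\<^sub>F n :: nat in at_top. real n powr (1 - \<kappa>) > 4"
      using \<kappa> by real_asymp
    moreover have "\<forall>\<^sub>F n :: nat in at_top. n > 0"
      by (rule eventually_gt_at_top)
    ultimately show ?thesis
    proof eventually_elim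
      case (elim n)
      have one: "real n powr \<kappa> \<ge> 1"
        using elim \<kappa> by (intro ge_one_powr_ge_zero) auto
      then have K: "real n powr \<kappa> \<le> real (K n)" "real (K n) \<le> 2 * real n powr \<kappa>" "K n > 0"
        unfolding K_def by linarith+
      have "real n powr (1 - \<kappa>) / 2 = real n / (2 * real n powr \<kappa>)"
        using elim by (simp add: powr_diff)
      also have "\<dots> \<le> real n / real (K n)"
        using K elim by (intro divide_left_mono mult_pos_pos) auto
      also have "\<dots> \<le> real (m n) + 1"
      proof -
        have "real n = real (m n) * real (K n) + real (n mod K n)"
          unfolding m_def by (metis div_mult_mod_eq of_nat_add of_nat_mult)
        moreover have "real (n mod K n) \<le> real (K n)"
          using K(3) by (simp add: less_imp_le)
        ultimately show ?thesis
          using K(3) by (simp add: pos_divide_le_eq distrib_right)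
      qed
      finally show ?case
        using elim one K(1) by auto
    qed
  qed
  have "filterlim (\<lambda>n. real n powr (1 - \<kappa>) / 4) at_top at_top"
    using \<kappa> by real_asymp
  then have "filterlim (\<lambda>n. real (m n)) at_top at_top"
    by (rule filterlim_at_top_mono) (use big_m in \<open>auto elim: eventually_mono\<close>)
  then have m_top: "filterlim (\<lambda>n. m n) at_top at_top"
    by (simp add: filterlim_real_sequentially filterlim_sequentially_iff_filterlim_real)
  have "k \<le> k ^ CARD('d)" for k :: nat
    by (cases "k = 0") (auto intro!: self_le_power)
  then have "\<forall>\<^sub>F n in at_top. m n \<le> m n ^ CARD('d)"
    by (intro always_eventually allI)
  then have "filterlim (\<lambda>n. m n ^ CARD('d)) at_top at_top"
    by (rule filterlim_at_top_mono[OF m_top])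
  then have dense: "\<forall>\<^sub>F n in at_top. \<exists>A \<subseteq> {0..<int (m n ^ CARD('d))}. sidon A \<and>
      real (m n ^ CARD('d)) powr (1 / 2 - \<delta>) \<le> real (card A)"
    using eventually_dense_sidon_interval[OF \<delta>(1,2)] by (rule eventually_compose_filterlim[rotated])
  have E1: "\<forall>\<^sub>F n :: nat in at_top. real n powr - (\<eta> / 4) \<le> (1 / g) powr (1 / 2 - \<delta>)"
  proof -
    have "(\<lambda>n. real n powr - (\<eta> / 4)) \<longlonglongrightarrow> 0"
      using assms by real_asymp
    then have "\<forall>\<^sub>F n :: nat in at_top. real n powr - (\<eta> / 4) < (1 / g) powr (1 / 2 - \<delta>)"
      by (rule order_tendstoD) (use \<open>g > 0\<close> in simp)
    then show ?thesis
      by eventually_elim simp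
  qed
  define r where "r = 1 / (2 * 2 ^ CARD('d) :: real)"
  have "r > 0"
    by (simp add: r_def)
  then show "(\<lambda>n. real n powr d * exp (- (r * real n powr \<eta>))) \<longlonglongrightarrow> 0"
    using assms \<open>d > 0\<close> by real_asymp
  show "\<forall>\<^sub>F n in at_top. measure_pmf.prob (random_grid n (p n))
           {\<omega> :: (int ^ 'd) set. real (max_sidon \<omega>) < real n powr ((a + d) / 2 - \<eta>)}
           \<le> real n powr d * exp (- (r * real n powr \<eta>))"
    using eventually_p_bounds big_m dense E1
  proof eventually_elim
    case (elim n)
    define x where "x = real n"
    have x: "x \<ge> 1"
      using elim by (auto simp: x_def)
    have N: "real n ^ CARD('d) = x powr d"
      using elim by (simp add: x_def d_def powr_realpow)
    have K: "x powr \<kappa> \<le> real (K n)" "K n > 0"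
      using elim by (auto simp: x_def intro: gr0I)
    have m: "x powr (1 - \<kappa>) / 4 \<le> real (m n)"
      using elim by (simp add: x_def)
    have "0 < x powr (1 - \<kappa>) / 4"
      using x by simp
    then have "m n > 0"
      using m by (intro gr0I) auto
    have mK: "m n * K n \<le> n"
      unfolding m_def by simp
    obtain A where A: "A \<subseteq> {0..<int (m n ^ CARD('d))}" "sidon A"
        "real (m n ^ CARD('d)) powr (1 / 2 - \<delta>) \<le> real (card A)"
      using elim by blast
    have pow_d: "(x powr e) ^ CARD('d) = x powr (e * d)" for e
      using x by (simp add: powr_power d_def mult.commute)
    have "x powr (a + d - \<eta>) / g = (x powr (1 - \<kappa>) / 4) ^ CARD('d)"
    proof -
      have "(1 - \<kappa>) * d = a + d - \<eta>"
        using \<kappa>(3) by (simp add: left_diff_distrib)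
      then show ?thesis
        unfolding power_divide pow_d g_def by simp
    qed
    also have "\<dots> \<le> real (m n ^ CARD('d))"
      using power_mono[OF m, of "CARD('d)"] by simp
    finally have M: "1 / g * x powr (a + d - \<eta>) \<le> real (m n ^ CARD('d))"
      by simp
    have "x powr ((a + d) / 2 - \<eta>) \<le> x powr (- (\<eta> / 4) + (a + d - \<eta>) * (1 / 2 - \<delta>))"
    proof (rule powr_mono[OF _ x])
      have "(a + d - \<eta>) * (1 / 2 - \<delta>) = (a + d) / 2 - \<eta> / 2 - \<delta> * (a + d) + \<eta> * \<delta>"
        by (simp add: field_simps)
      moreover have "0 \<le> \<eta> * \<delta>"
        using assms \<delta> by simp
      ultimately show "(a + d) / 2 - \<eta> \<le> - (\<eta> / 4) + (a + d - \<eta>) * (1 / 2 - \<delta>)"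
        using \<delta>(3) by linarith
    qed
    also have "\<dots> = x powr - (\<eta> / 4) * (x powr (a + d - \<eta>)) powr (1 / 2 - \<delta>)"
      by (simp only: powr_add powr_powr)
    also have "\<dots> \<le> (1 / g) powr (1 / 2 - \<delta>) * (x powr (a + d - \<eta>)) powr (1 / 2 - \<delta>)"
      using elim by (intro mult_right_mono) (auto simp: x_def)
    also have "\<dots> = (1 / g * x powr (a + d - \<eta>)) powr (1 / 2 - \<delta>)"
      by (rule powr_mult[symmetric]; use \<open>g > 0\<close> in simp)
    also have "\<dots> \<le> real (m n ^ CARD('d)) powr (1 / 2 - \<delta>)"
      using M \<delta> \<open>g > 0\<close> by (intro powr_mono2) auto
    also have "\<dots> \<le> real (card A)"
      by (rule A(3))
    finally have big: "x powr ((a + d) / 2 - \<eta>) \<le> real (card A)" .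
    have "r * x powr \<eta> = x powr a / 2 * (x powr \<kappa> / 2) ^ CARD('d)"
      unfolding power_divide pow_d \<kappa>(3) using x by (simp add: r_def powr_diff)
    also have "\<dots> \<le> p n * (real (K n) / 2) ^ CARD('d)"
      using elim K by (intro mult_mono power_mono) (auto simp: x_def)
    finally have exponent: "r * x powr \<eta> \<le> p n * (real (K n) / 2) ^ CARD('d)" .
    have "measure_pmf.prob (random_grid n (p n)) {\<omega> :: (int ^ 'd) set. real (max_sidon \<omega>) < real n powr ((a + d) / 2 - \<eta>)}
        \<le> measure_pmf.prob (random_grid n (p n)) {\<omega> :: (int ^ 'd) set. max_sidon \<omega> < card A}"
      by (rule measure_pmf.finite_measure_mono) (use big in \<open>auto simp: x_def\<close>)
    also have "\<dots> \<le> real n ^ CARD('d) * exp (- p n * (real (K n) / 2) ^ CARD('d))"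
      using elim K(2) \<open>m n > 0\<close> mK A by (intro prob_max_sidon_less_dense) auto
    also have "\<dots> \<le> x powr d * exp (- (r * x powr \<eta>))"
      unfolding N using exponent by (intro mult_left_mono) auto
    finally show ?case
      by (simp add: x_def)
  qed
qed

text \<open>
  Both case distinctions pick the bound that determines the exponent \<open>b\<close>; for the lower bound in the
  case \<open>(a + d) / 2 < d / 3\<close> the exponent is \<open>min (a + d) (d / 3)\<close>.
\<close>

lemma aas_power_max_sidon:
  fixes d :: real
  defines "d \<equiv> real CARD('d::finite)"
  assumes "- d < a" "a \<le> 0"
  shows "aas_power (\<lambda>n. random_grid n (p n) :: (int ^ 'd) set pmf) max_sidon (min (a + d) (max (d / 3) ((a + d) / 2)))"
proof (rule aas_power_if_bad_events_vanish)
  have "d > 0"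
    by (simp add: d_def)
  let ?b = "min (a + d) (max (d / 3) ((a + d) / 2))"
  show "?b > 0"
    using assms \<open>d > 0\<close> by auto
  fix \<eta> :: real assume "0 < \<eta>"
  show "(\<lambda>n. measure_pmf.prob (random_grid n (p n)) {\<omega> :: (int ^ 'd) set. real n powr (?b + \<eta>) < real (max_sidon \<omega>)}) \<longlonglongrightarrow> 0"
  proof (cases "a + d \<le> max (d / 3) ((a + d) / 2)")
    case True
    then show ?thesis
      using max_sidon_upper_trivial[OF \<open>0 < \<eta>\<close>, where ?'d = 'd] by (simp add: d_def)
  next
    case False
    then have "?b = max (d / 3) ((a + d) / 2)"
      by simp
    then have "d \<le> 3 * ?b" "a + d \<le> 2 * ?b"
      by (simp_all add: max_def)
    then show ?thesis
      using max_sidon_upper_containers[OF \<open>0 < \<eta>\<close>, where ?'d = 'd and b = ?b] by (simp add: d_def)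
  qed
  assume "\<eta> < ?b"
  show "(\<lambda>n. measure_pmf.prob (random_grid n (p n)) {\<omega> :: (int ^ 'd) set. real (max_sidon \<omega>) < real n powr (?b - \<eta>)}) \<longlonglongrightarrow> 0"
  proof (cases "d / 3 \<le> (a + d) / 2")
    case True
    then have b: "?b = (a + d) / 2"
      using assms by auto
    have "\<eta> < (a + d) / 2"
      using \<open>\<eta> < ?b\<close> unfolding b .
    then show ?thesis
      unfolding b using max_sidon_lower_blowup[OF \<open>a \<le> 0\<close> \<open>0 < \<eta>\<close>, where ?'d = 'd] by (simp add: d_def)
  next
    case False
    then have "?b \<le> a + d" "3 * ?b \<le> d"
      by (simp_all add: min_def max_def)
    then show ?thesis
      using max_sidon_lower_maximal[OF \<open>0 < \<eta>\<close> \<open>\<eta> < ?b\<close>, where ?'d = 'd] by (simp add: d_def)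
  qed
qed

end

theorem theorem1p3:
  fixes a d :: real
  defines "d \<equiv> real CARD('d::finite)"
  assumes "- d < a" and "a \<le> 0"
  shows "\<exists>b::real.
    (\<forall>p :: nat \<Rightarrow> real.
       (\<forall>n>0. 0 \<le> p n \<and> p n \<le> 1) \<longrightarrow>
       p \<sim>[at_top] (\<lambda>n. real n powr a) \<longrightarrow>
       aas_power (\<lambda>n. random_grid n (p n) :: (int ^ 'd) set pmf) max_sidon b) \<and>
    (- d < a \<and> a \<le> - 2 * d / 3 \<longrightarrow> b = a + d) \<and>
    (- 2 * d / 3 \<le> a \<and> a \<le> - d / 3 \<longrightarrow> b = d / 3) \<and>
    (- d / 3 \<le> a \<and> a \<le> 0 \<longrightarrow> b = (a + d) / 2)"
proof (intro exI[of _ "min (a + d) (max (d / 3) ((a + d) / 2))"] conjI allI impI)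
  have "d > 0"
    by (simp add: d_def)
  fix p :: "nat \<Rightarrow> real"
  assume "\<forall>n>0. 0 \<le> p n \<and> p n \<le> 1" "p \<sim>[at_top] (\<lambda>n. real n powr a)"
  then show "aas_power (\<lambda>n. random_grid n (p n) :: (int ^ 'd) set pmf) max_sidon (min (a + d) (max (d / 3) ((a + d) / 2)))"
    using assms(2,3) unfolding d_def by (intro aas_power_max_sidon) auto
qed (use assms(2,3) in \<open>auto simp: min_def max_def\<close>)

end
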